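(* Let $M_4,\dots,M_8$ be the following structures for the language $L=\{\emptyset,\langle\cdot\rangle,\uplus,\sqsubseteq\}$: - $M_4$: domain $\mathbb{N}$, $\emptyset:=0$, $\langle x\rangle:=x+1$, $x\uplus y:=\max(x,y)$, $x\sqsubseteq t$ iff $x\le t$; - $M_5$: domain $\{0\}$, $\emptyset:=0$, $\langle x\rangle:=0$, $x\uplus y:=0$, $x\sqsubseteq t$ iff $x=t=0$; - $M_6$: domain $\mathbb{Z}$, $\emptyset:=0$, $\langle x\rangle:=2x+1$, $x\uplus y:=x+y$, $x\sqsubseteq t$ always; - $M_7$: domain $\mathbb{N}$, $\emptyset:=0$, $\langle x\rangle:=1$, $x\uplus y:=x+y$, $x\sqsubseteq t$ iff $t\ge1$ or ($x=0$ and $t=0$); - $M_8$: domain $\mathbb{N}$, $\emptyset:=0$, $\langle x\rangle:=x+1$, $x\uplus y:=x+y$, $x\sqsubseteq t$ iff $x\le t$. For each $i\in\{4,\dots,8\}$, the structure $M_i$ satisfies every axiom of $\mathsf{F}^{-}$ except $\mathrm{F}_i$, refutes $\mathrm{F}_i$, and has a decidable complete first-order theory. Consequently, writing $\mathsf{F}^{-}{-}\mathrm{F}_i$ for the theory axiomatized by the other eight axioms: (i) $\mathrm{F}_i$ is not derivable in $\mathsf{F}^{-}{-}\mathrm{F}_i$; (ii) $\mathrm{Th}(M_i)$ is a consistent decidable complete extension of $\mathsf{F}^{-}{-}\mathrm{F}_i$, so $\mathsf{F}^{-}{-}\mathrm{F}_i$ is not essentially undecidable. In this sense the axiomatization of $\mathsf{F}^{-}$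 is minimal at each of the axioms $\mathrm{F}_4,\dots,\mathrm{F}_8$.
   Context: The theory $\mathsf{F}^{-}$ is a first-order theory with equality in the language $L=\{\emptyset,\langle\cdot\rangle,\uplus,\sqsubseteq\}$ (constant, unary function, binary function, binary relation), with axioms (all free variables universally quantified): $\mathrm{F}_1$: $(x\uplus y)\uplus z=x\uplus(y\uplus z)$; $\mathrm{F}_2$: $x\uplus y=y\uplus x$; $\mathrm{F}_3$: $x\uplus\emptyset=x$; $\mathrm{F}_4$: $x\uplus z=y\uplus z\rightarrow x=y$; $\mathrm{F}_5$: $\langle x\rangle\ne\emptyset$; $\mathrm{F}_6$: $x\uplus y=\emptyset\rightarrow x=\emptyset$; $\mathrm{F}_7$: $\langle x\rangle=\langle y\rangle\rightarrow x=y$; $\mathrm{F}_8$: $u\uplus v=\langle x\rangle\uplus w\rightarrow\exists w'\,(u=\langle x\rangle\uplus w'\vee v=\langle x\rangle\uplus w')$; $\mathrm{F}_9$: $x\sqsubseteq t\leftrightarrow\bigl(x=t\vee\exists w\,\exists u\,(t=w\uplus\langle u\rangle\wedge x\sqsubseteq u)\bigr)$. A consistent theory is essentially undecidable if no consistent extension of it in the same language is decidable. $\mathrm{Th}(M)$ is the complete first-order theory of $M$. *)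

theory Defs
  imports Main "HOL-Library.Nat_Bijection" "HOL-Library.Numeral_Type"
begin

datatype trm =
    Var nat
  | Emp  ("\<^bold>\<emptyset>")
  | Sing trm  ("\<langle>_\<rangle>")
  | Uni trm trm  (infixl "\<uplus>" 75)

datatype fm =
    Eq trm trm  (infix "\<doteq>" 65)
  | Sub trm trm  (infix "\<sqsubseteq>" 65)
  | Neg fm  ("\<^bold>\<not> _" [60] 60)
  | Imp fm fm  (infixr "\<^bold>\<longrightarrow>" 45)
  | All nat fm  ("\<^bold>\<forall>_. _" [0, 40] 40)

definition Con :: "fm \<Rightarrow> fm \<Rightarrow> fm"  (infixr "\<^bold>\<and>" 55) where
  "\<phi> \<^bold>\<and> \<psi> = \<^bold>\<not> (\<phi> \<^bold>\<longrightarrow> \<^bold>\<not> \<psi>)"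

definition Dis :: "fm \<Rightarrow> fm \<Rightarrow> fm"  (infixr "\<^bold>\<or>" 50) where
  "\<phi> \<^bold>\<or> \<psi> = (\<^bold>\<not> \<phi> \<^bold>\<longrightarrow> \<psi>)"

definition Iff :: "fm \<Rightarrow> fm \<Rightarrow> fm"  (infix "\<^bold>\<longleftrightarrow>" 45) where
  "(\<phi> \<^bold>\<longleftrightarrow> \<psi>) = ((\<phi> \<^bold>\<longrightarrow> \<psi>) \<^bold>\<and> (\<psi> \<^bold>\<longrightarrow> \<phi>))"

definition Exi :: "nat \<Rightarrow> fm \<Rightarrow> fm"  ("\<^bold>\<exists>_. _" [0, 40] 40) where
  "(\<^bold>\<exists>x. \<phi>) = \<^bold>\<not> (\<^bold>\<forall>x. \<^bold>\<not> \<phi>)"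

primrec fv_trm :: "trm \<Rightarrow> nat set" where
  "fv_trm (Var x) = {x}"
| "fv_trm \<^bold>\<emptyset> = {}"
| "fv_trm \<langle>t\<rangle> = fv_trm t"
| "fv_trm (s \<uplus> t) = fv_trm s \<union> fv_trm t"

primrec fv :: "fm \<Rightarrow> nat set" where
  "fv (s \<doteq> t) = fv_trm s \<union> fv_trm t"
| "fv (s \<sqsubseteq> t) = fv_trm s \<union> fv_trm t"
| "fv (\<^bold>\<not> \<phi>) = fv \<phi>"
| "fv (\<phi> \<^bold>\<longrightarrow> \<psi>) = fv \<phi> \<union> fv \<psi>"
| "fv (\<^bold>\<forall>x. \<phi>) = fv \<phi> - {x}"

definition sentence :: "fm \<Rightarrow> bool" where
  "sentence \<phi> \<longleftrightarrow> fv \<phi> = {}"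

primrec subst_trm :: "trm \<Rightarrow> nat \<Rightarrow> trm \<Rightarrow> trm" where
  "subst_trm (Var y) x s = (if y = x then s else Var y)"
| "subst_trm \<^bold>\<emptyset> x s = \<^bold>\<emptyset>"
| "subst_trm \<langle>t\<rangle> x s = \<langle>subst_trm t x s\<rangle>"
| "subst_trm (t \<uplus> u) x s = subst_trm t x s \<uplus> subst_trm u x s"

text \<open>Replacement of the free occurrences of a variable. It does not rename bound variables, so
  it is only used under the side condition \<open>free_for\<close>.\<close>

primrec subst :: "fm \<Rightarrow> nat \<Rightarrow> trm \<Rightarrow> fm" where
  "subst (t \<doteq> u) x s = (subst_trm t x s \<doteq> subst_trm u x s)"
| "subst (t \<sqsubseteq> u) x s = (subst_trm t x s \<sqsubseteq> subst_trm u x s)"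
| "subst (\<^bold>\<not> \<phi>) x s = \<^bold>\<not> (subst \<phi> x s)"
| "subst (\<phi> \<^bold>\<longrightarrow> \<psi>) x s = (subst \<phi> x s \<^bold>\<longrightarrow> subst \<psi> x s)"
| "subst (\<^bold>\<forall>y. \<phi>) x s = (\<^bold>\<forall>y. (if y = x then \<phi> else subst \<phi> x s))"

primrec free_for :: "trm \<Rightarrow> nat \<Rightarrow> fm \<Rightarrow> bool" where
  "free_for s x (t \<doteq> u) = True"
| "free_for s x (t \<sqsubseteq> u) = True"
| "free_for s x (\<^bold>\<not> \<phi>) = free_for s x \<phi>"
| "free_for s x (\<phi> \<^bold>\<longrightarrow> \<psi>) = (free_for s x \<phi> \<and> free_for s x \<psi>)"
| "free_for s x (\<^bold>\<forall>y. \<phi>) = (x \<notin> fv \<phi> - {y} \<or> y \<notin> fv_trm s \<and> free_for s x \<phi>)"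

text \<open>A Hilbert calculus in the style of Mendelson for classical first-order logic with equality.\<close>

inductive derives :: "fm set \<Rightarrow> fm \<Rightarrow> bool"  (infix "\<turnstile>" 35) for T where
  Ax: "\<phi> \<in> T \<Longrightarrow> T \<turnstile> \<phi>"
| P1: "T \<turnstile> \<phi> \<^bold>\<longrightarrow> \<psi> \<^bold>\<longrightarrow> \<phi>"
| P2: "T \<turnstile> (\<phi> \<^bold>\<longrightarrow> \<psi> \<^bold>\<longrightarrow> \<chi>) \<^bold>\<longrightarrow> (\<phi> \<^bold>\<longrightarrow> \<psi>) \<^bold>\<longrightarrow> \<phi> \<^bold>\<longrightarrow> \<chi>"
| P3: "T \<turnstile> (\<^bold>\<not> \<phi> \<^bold>\<longrightarrow> \<^bold>\<not> \<psi>) \<^bold>\<longrightarrow> \<psi> \<^bold>\<longrightarrow> \<phi>"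
| Inst: "free_for s x \<phi> \<Longrightarrow> T \<turnstile> (\<^bold>\<forall>x. \<phi>) \<^bold>\<longrightarrow> subst \<phi> x s"
| Distr: "x \<notin> fv \<phi> \<Longrightarrow> T \<turnstile> (\<^bold>\<forall>x. (\<phi> \<^bold>\<longrightarrow> \<psi>)) \<^bold>\<longrightarrow> \<phi> \<^bold>\<longrightarrow> (\<^bold>\<forall>x. \<psi>)"
| Refl: "T \<turnstile> s \<doteq> s"
| Leibniz: "free_for s x \<phi> \<Longrightarrow> free_for t x \<phi> \<Longrightarrow> T \<turnstile> s \<doteq> t \<^bold>\<longrightarrow> subst \<phi> x s \<^bold>\<longrightarrow> subst \<phi> x t"
| MP: "T \<turnstile> \<phi> \<^bold>\<longrightarrow> \<psi> \<Longrightarrow> T \<turnstile> \<phi> \<Longrightarrow> T \<turnstile> \<psi>"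
| Gen: "T \<turnstile> \<phi> \<Longrightarrow> T \<turnstile> (\<^bold>\<forall>x. \<phi>)"

text \<open>The domain of a structure is the whole (automatically nonempty) type \<open>'a\<close>.\<close>

record 'a lstruct =
  emp_of :: 'a
  sing_of :: "'a \<Rightarrow> 'a"
  uni_of :: "'a \<Rightarrow> 'a \<Rightarrow> 'a"
  sub_of :: "'a \<Rightarrow> 'a \<Rightarrow> bool"

primrec val :: "'a lstruct \<Rightarrow> (nat \<Rightarrow> 'a) \<Rightarrow> trm \<Rightarrow> 'a" where
  "val M e (Var x) = e x"
| "val M e \<^bold>\<emptyset> = emp_of M"
| "val M e \<langle>t\<rangle> = sing_of M (val M e t)"
| "val M e (s \<uplus> t) = uni_of M (val M e s) (val M e t)"

primrec sat :: "'a lstruct \<Rightarrow> (nat \<Rightarrow> 'a) \<Rightarrow> fm \<Rightarrow> bool" where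
  "sat M e (s \<doteq> t) \<longleftrightarrow> val M e s = val M e t"
| "sat M e (s \<sqsubseteq> t) \<longleftrightarrow> sub_of M (val M e s) (val M e t)"
| "sat M e (\<^bold>\<not> \<phi>) \<longleftrightarrow> \<not> sat M e \<phi>"
| "sat M e (\<phi> \<^bold>\<longrightarrow> \<psi>) \<longleftrightarrow> (sat M e \<phi> \<longrightarrow> sat M e \<psi>)"
| "sat M e (\<^bold>\<forall>x. \<phi>) \<longleftrightarrow> (\<forall>a. sat M (e(x := a)) \<phi>)"

definition models :: "'a lstruct \<Rightarrow> fm \<Rightarrow> bool"  (infix "\<Turnstile>" 35) where
  "(M \<Turnstile> \<phi>) \<longleftrightarrow> (\<forall>e. sat M e \<phi>)"

definition Th :: "'a lstruct \<Rightarrow> fm set" where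
  "Th M = {\<phi>. sentence \<phi> \<and> M \<Turnstile> \<phi>}"

text \<open>Kleene's partial recursive functions, given by their graphs. In \<open>PrimRec\<close> the recursion
  argument comes first and is followed, in the step function, by the previous value; \<open>Mu\<close>
  minimises over the first argument and requires all earlier values to be defined and positive.\<close>

datatype recf =
    Zero
  | Succ
  | Proj nat
  | Comp recf "recf list"
  | PrimRec recf recf
  | Mu recf

inductive computes :: "recf \<Rightarrow> nat list \<Rightarrow> nat \<Rightarrow> bool" where
  zero: "computes Zero xs 0"
| succ: "computes Succ [x] (Suc x)"
| proj: "i < length xs \<Longrightarrow> computes (Proj i) xs (xs ! i)"
| comp: "list_all2 (\<lambda>g y. computes g xs y) gs ys \<Longrightarrow> computes f ys z \<Longrightarrow> computes (Comp f gs) xs z"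
| rec_0: "computes f xs y \<Longrightarrow> computes (PrimRec f g) (0 # xs) y"
| rec_Suc: "computes (PrimRec f g) (n # xs) y \<Longrightarrow> computes g (n # y # xs) z \<Longrightarrow>
    computes (PrimRec f g) (Suc n # xs) z"
| mu: "computes f (n # xs) 0 \<Longrightarrow> \<forall>m<n. \<exists>v. computes f (m # xs) (Suc v) \<Longrightarrow> computes (Mu f) xs n"

definition recursive_set :: "nat set \<Rightarrow> bool" where
  "recursive_set A \<longleftrightarrow> (\<exists>f. \<forall>n. computes f [n] (if n \<in> A then 1 else 0))"

primrec trm_code :: "trm \<Rightarrow> nat" where
  "trm_code (Var x) = prod_encode (0, x)"
| "trm_code \<^bold>\<emptyset> = prod_encode (1, 0)"
| "trm_code \<langle>t\<rangle> = prod_encode (2, trm_code t)"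
| "trm_code (s \<uplus> t) = prod_encode (3, prod_encode (trm_code s, trm_code t))"

primrec fm_code :: "fm \<Rightarrow> nat" where
  "fm_code (s \<doteq> t) = prod_encode (0, prod_encode (trm_code s, trm_code t))"
| "fm_code (s \<sqsubseteq> t) = prod_encode (1, prod_encode (trm_code s, trm_code t))"
| "fm_code (\<^bold>\<not> \<phi>) = prod_encode (2, fm_code \<phi>)"
| "fm_code (\<phi> \<^bold>\<longrightarrow> \<psi>) = prod_encode (3, prod_encode (fm_code \<phi>, fm_code \<psi>))"
| "fm_code (\<^bold>\<forall>x. \<phi>) = prod_encode (4, prod_encode (x, fm_code \<phi>))"

text \<open>A theory is given by a set of sentences, its axioms.\<close>

definition fo_theory :: "fm set \<Rightarrow> bool" where
  "fo_theory T \<longleftrightarrow> (\<forall>\<phi>\<in>T. sentence \<phi>)"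

definition consistent :: "fm set \<Rightarrow> bool" where
  "consistent T \<longleftrightarrow> \<not> (\<exists>\<phi>. (T \<turnstile> \<phi>) \<and> (T \<turnstile> \<^bold>\<not> \<phi>))"

definition complete_theory :: "fm set \<Rightarrow> bool" where
  "complete_theory T \<longleftrightarrow> (\<forall>\<phi>. sentence \<phi> \<longrightarrow> (T \<turnstile> \<phi>) \<or> (T \<turnstile> \<^bold>\<not> \<phi>))"

definition decidable_theory :: "fm set \<Rightarrow> bool" where
  "decidable_theory T \<longleftrightarrow> recursive_set (fm_code ` {\<phi>. sentence \<phi> \<and> (T \<turnstile> \<phi>)})"

definition extends :: "fm set \<Rightarrow> fm set \<Rightarrow> bool" where
  "extends T' T \<longleftrightarrow> fo_theory T' \<and> (\<forall>\<phi>. (T \<turnstile> \<phi>) \<longrightarrow> (T' \<turnstile> \<phi>))"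

definition essentially_undecidable :: "fm set \<Rightarrow> bool" where
  "essentially_undecidable T \<longleftrightarrow>
     consistent T \<and> (\<forall>T'. extends T' T \<and> consistent T' \<longrightarrow> \<not> decidable_theory T')"

text \<open>The axioms are the universal closures of the displayed formulas.\<close>

definition F1 :: fm where
  "F1 = (\<^bold>\<forall>0. \<^bold>\<forall>1. \<^bold>\<forall>2. (Var 0 \<uplus> Var 1) \<uplus> Var 2 \<doteq> Var 0 \<uplus> (Var 1 \<uplus> Var 2))"

definition F2 :: fm where
  "F2 = (\<^bold>\<forall>0. \<^bold>\<forall>1. Var 0 \<uplus> Var 1 \<doteq> Var 1 \<uplus> Var 0)"

definition F3 :: fm where
  "F3 = (\<^bold>\<forall>0. Var 0 \<uplus> \<^bold>\<emptyset> \<doteq> Var 0)"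

definition F4 :: fm where
  "F4 = (\<^bold>\<forall>0. \<^bold>\<forall>1. \<^bold>\<forall>2. Var 0 \<uplus> Var 2 \<doteq> Var 1 \<uplus> Var 2 \<^bold>\<longrightarrow> Var 0 \<doteq> Var 1)"

definition F5 :: fm where
  "F5 = (\<^bold>\<forall>0. \<^bold>\<not> (\<langle>Var 0\<rangle> \<doteq> \<^bold>\<emptyset>))"

definition F6 :: fm where
  "F6 = (\<^bold>\<forall>0. \<^bold>\<forall>1. Var 0 \<uplus> Var 1 \<doteq> \<^bold>\<emptyset> \<^bold>\<longrightarrow> Var 0 \<doteq> \<^bold>\<emptyset>)"

definition F7 :: fm where
  "F7 = (\<^bold>\<forall>0. \<^bold>\<forall>1. \<langle>Var 0\<rangle> \<doteq> \<langle>Var 1\<rangle> \<^bold>\<longrightarrow> Var 0 \<doteq> Var 1)"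

text \<open>Below, the variables x, u, v, w, w' are numbered 0, 1, 2, 3, 4.\<close>

definition F8 :: fm where
  "F8 = (\<^bold>\<forall>0. \<^bold>\<forall>1. \<^bold>\<forall>2. \<^bold>\<forall>3. Var 1 \<uplus> Var 2 \<doteq> \<langle>Var 0\<rangle> \<uplus> Var 3 \<^bold>\<longrightarrow>
     (\<^bold>\<exists>4. (Var 1 \<doteq> \<langle>Var 0\<rangle> \<uplus> Var 4) \<^bold>\<or> (Var 2 \<doteq> \<langle>Var 0\<rangle> \<uplus> Var 4)))"

text \<open>Below, the variables x, t, w, u are numbered 0, 1, 2, 3.\<close>

definition F9 :: fm where
  "F9 = (\<^bold>\<forall>0. \<^bold>\<forall>1. (Var 0 \<sqsubseteq> Var 1 \<^bold>\<longleftrightarrow>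
     (Var 0 \<doteq> Var 1 \<^bold>\<or> (\<^bold>\<exists>2. \<^bold>\<exists>3. (Var 1 \<doteq> Var 2 \<uplus> \<langle>Var 3\<rangle>) \<^bold>\<and> (Var 0 \<sqsubseteq> Var 3)))))"

text \<open>\<open>F i\<close> is only meaningful for \<open>1 \<le> i \<le> 9\<close>.\<close>

definition F :: "nat \<Rightarrow> fm" where
  "F i = [F1, F2, F3, F4, F5, F6, F7, F8, F9] ! (i - 1)"

definition Fminus :: "fm set" where
  "Fminus = F ` {1..9}"

definition Fminus_without :: "nat \<Rightarrow> fm set" where
  "Fminus_without i = F ` ({1..9} - {i})"

definition M4 :: "nat lstruct" where
  "M4 = \<lparr>emp_of = 0, sing_of = (\<lambda>x. x + 1), uni_of = (\<lambda>x y. max x y), sub_of = (\<lambda>x t. x \<le> t)\<rparr>"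

text \<open>\<open>num1\<close> is the one-element type, whose only element is \<open>0\<close>.\<close>

definition M5 :: "num1 lstruct" where
  "M5 = \<lparr>emp_of = 0, sing_of = (\<lambda>x. 0), uni_of = (\<lambda>x y. 0), sub_of = (\<lambda>x t. x = t \<and> t = 0)\<rparr>"

definition M6 :: "int lstruct" where
  "M6 = \<lparr>emp_of = 0, sing_of = (\<lambda>x. 2 * x + 1), uni_of = (\<lambda>x y. x + y), sub_of = (\<lambda>x t. True)\<rparr>"

definition M7 :: "nat lstruct" where
  "M7 = \<lparr>emp_of = 0, sing_of = (\<lambda>x. 1), uni_of = (\<lambda>x y. x + y),
         sub_of = (\<lambda>x t. t \<ge> 1 \<or> x = 0 \<and> t = 0)\<rparr>"

definition M8 :: "nat lstruct" where
  "M8 = \<lparr>emp_of = 0, sing_of = (\<lambda>x. x + 1), uni_of = (\<lambda>x y. x + y), sub_of = (\<lambda>x t. x \<le> t)\<rparr>"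

end

theory Submission
  imports Defs
begin

text \<open>
  Checking the axioms in each \<open>M\<^sub>i\<close> is elementary; the point is the decidability of \<open>Th M\<^sub>i\<close>. Outside
  the one-element \<open>M\<^sub>5\<close>, the value of a term is a small integer linear form in the variables; for
  \<open>max\<close>, the form depends on the outcome of finitely many comparisons between such forms. Hence an
  Ehrenfeucht-Fraisse argument in the style of Ferrante and Rackoff for Presburger arithmetic applies:
  assignments that agree on the signs of all linear forms with small coefficients and on residues
  modulo a factorial satisfy the same formulas of a given code, and every quantifier can be bounded by
  a computable function of the formula and of the current values. Truth of a sentence is then
  evaluated by a recursion with bounded quantifiers. Its values are found by searching for a finite
  table that passes a local consistency check, so no more than closure of the recursive functions
  under primitive recursion and minimisation is needed.
\<close>

section \<open>Closure properties of recursive functions\<close>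

text \<open>The code of a formula doubles as its complexity measure: it bounds the codes of the
  subformulas and the indices of the variables, and \<open>2\<close> to its power bounds the
  coefficients of the terms. One number therefore fixes how many variables are in play, the
  precision and the quantifier bound, and no further syntactic measure has to be computed. A
  quantifier alters the environment, so evaluation is not a recursion on the code with a fixed
  parameter; a table indexed by code and environment is indifferent to this. The factorial has two
  roles. \<open>fact L\<close> is a common multiple of all nonzero coefficients up to
  \<open>L\<close>, so every comparison with a new value can be scaled to the single coefficient
  \<open>fact L\<close>; and a suitable integer for the answer is found only if one can divide by
  that coefficient again, which is what the residues are for.\<close>

text \<open>Arguments are read off an infinite environment, as de Bruijn indices, so that primitive recursion,
  minimisation and bounded quantifiers become higher-order introduction rules without arities.\<close>

definition computable :: "((nat \<Rightarrow> nat) \<Rightarrow> nat) \<Rightarrow> bool" where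
  "computable f \<longleftrightarrow> (\<exists>r n. \<forall>\<rho>. \<forall>m\<ge>n. computes r (map \<rho> [0..<m]) (f \<rho>))"

definition decidable :: "((nat \<Rightarrow> nat) \<Rightarrow> bool) \<Rightarrow> bool" where
  "decidable P \<longleftrightarrow> computable (\<lambda>\<rho>. if P \<rho> then 1 else 0)"

named_theorems computable_intros

lemma computable_var [computable_intros]: "computable (\<lambda>\<rho>. \<rho> k)"
proof -
  have "computes (Proj k) (map \<rho> [0..<m]) (\<rho> k)" if "m \<ge> Suc k" for \<rho> m
    using proj[of k "map \<rho> [0..<m]"] that by simp
  then show ?thesis unfolding computable_def by blast
qed

lemma computable_const [computable_intros]: "computable (\<lambda>\<rho>. k)"
proof (induction k)
  case 0
  show ?case unfolding computable_def by (blast intro: zero)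
next
  case (Suc k)
  then obtain r n where r: "\<forall>\<rho>. \<forall>m\<ge>n. computes r (map \<rho> [0..<m]) k"
    unfolding computable_def by blast
  have "computes (Comp Succ [r]) (map \<rho> [0..<m]) (Suc k)" if "m \<ge> n" for \<rho> m
    by (rule comp[where ys = "[k]"]) (use r that in \<open>auto intro: succ\<close>)
  then show ?case unfolding computable_def by blast
qed

text \<open>The program for \<open>h\<close> already answers on its first \<open>n\<close>
  arguments, so only \<open>n\<close> members of the infinite family \<open>\<sigma>\<close> enter
  the composition.\<close>

lemma computable_subst:
  assumes h: "computable h" and \<sigma>: "\<And>i. computable (\<sigma> i)"
  shows "computable (\<lambda>\<rho>. h (\<lambda>i. \<sigma> i \<rho>))"
proof -
  obtain r n where r: "\<And>\<rho> m. m \<ge> n \<Longrightarrow> computes r (map \<rho> [0..<m]) (h \<rho>)"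
    using h unfolding computable_def by blast
  have "\<forall>i. \<exists>s k. \<forall>\<rho>. \<forall>m\<ge>k. computes s (map \<rho> [0..<m]) (\<sigma> i \<rho>)"
    using \<sigma> unfolding computable_def by blast
  then obtain s k where s: "\<And>i \<rho> m. m \<ge> k i \<Longrightarrow> computes (s i) (map \<rho> [0..<m]) (\<sigma> i \<rho>)"
    by metis
  have "computes (Comp r (map s [0..<n])) (map \<rho> [0..<m]) (h (\<lambda>i. \<sigma> i \<rho>))"
    if m: "m \<ge> (\<Sum>i<n. k i)" for \<rho> m
  proof (rule comp)
    have "k i \<le> m" if "i < n" for i
      using member_le_sum[of i "{..<n}" k] that m by simp
    then show "list_all2 (\<lambda>g y. computes g (map \<rho> [0..<m]) y) (map s [0..<n])
        (map (\<lambda>i. \<sigma> i \<rho>) [0..<n])"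
      by (auto simp: list_all2_conv_all_nth intro: s)
    show "computes r (map (\<lambda>i. \<sigma> i \<rho>) [0..<n]) (h (\<lambda>i. \<sigma> i \<rho>))"
      by (rule r) simp
  qed
  then show ?thesis unfolding computable_def by blast
qed

lemma computable_comp1:
  assumes "computable (\<lambda>\<rho>. h (\<rho> 0))" "computable f"
  shows "computable (\<lambda>\<rho>. h (f \<rho>))"
  using computable_subst[OF assms(1), of "\<lambda>i. f"] assms(2) by simp

lemma computable_comp2:
  assumes "computable (\<lambda>\<rho>. h (\<rho> 0) (\<rho> 1))" "computable f" "computable g"
  shows "computable (\<lambda>\<rho>. h (f \<rho>) (g \<rho>))"
  using computable_subst[OF assms(1), of "\<lambda>i. if i = 0 then f else g"] assms(2,3) by simp

lemma computable_comp3: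
  assumes "computable (\<lambda>\<rho>. h (\<rho> 0) (\<rho> 1) (\<rho> 2))" "computable f" "computable g" "computable k"
  shows "computable (\<lambda>\<rho>. h (f \<rho>) (g \<rho>) (k \<rho>))"
  using computable_subst[OF assms(1), of "\<lambda>i. if i = 0 then f else if i = 1 then g else k"]
    assms(2-4) by simp

lemma decidable_comp2:
  assumes "decidable (\<lambda>\<rho>. P (\<rho> 0) (\<rho> 1))" "computable f" "computable g"
  shows "decidable (\<lambda>\<rho>. P (f \<rho>) (g \<rho>))"
  using assms computable_comp2[where h = "\<lambda>x y. if P x y then 1 else 0"]
  unfolding decidable_def by blast

lemma decidable_comp4:
  assumes "decidable (\<lambda>\<rho>. P (\<rho> 0) (\<rho> 1) (\<rho> 2) (\<rho> 3))"
    "computable f" "computable g" "computable h" "computable k"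
  shows "decidable (\<lambda>\<rho>. P (f \<rho>) (g \<rho>) (h \<rho>) (k \<rho>))"
  using computable_subst[OF assms(1)[unfolded decidable_def],
      of "\<lambda>i. if i = 0 then f else if i = 1 then g else if i = 2 then h else k"] assms(2-5)
  unfolding decidable_def by simp

lemma computable_Suc [computable_intros]:
  assumes "computable f" shows "computable (\<lambda>\<rho>. Suc (f \<rho>))"
proof -
  obtain r n where r: "\<forall>\<rho>. \<forall>m\<ge>n. computes r (map \<rho> [0..<m]) (f \<rho>)"
    using assms unfolding computable_def by blast
  have "computes (Comp Succ [r]) (map \<rho> [0..<m]) (Suc (f \<rho>))" if "m \<ge> n" for \<rho> m
    by (rule comp[where ys = "[f \<rho>]"]) (use r that in \<open>auto intro: succ\<close>)
  then show ?thesis unfolding computable_def by blast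
qed

lemma map_upt_Cons: "x # map \<rho> [0..<m] = map (case_nat x \<rho>) [0..<Suc m]"
  by (simp add: map_upt_Suc del: upt_Suc)

text \<open>In the step, index 0 is the counter and index 1 the previous value, which is the
  argument order of \<open>PrimRec\<close>; the parameters move up by two.\<close>

lemma computable_rec [computable_intros]:
  assumes b: "computable b" and s: "computable (\<lambda>\<rho>. s (\<rho> 0) (\<rho> (Suc 0)) (\<lambda>i. \<rho> (Suc (Suc i))))"
    and k: "computable k"
  shows "computable (\<lambda>\<rho>. rec_nat (b \<rho>) (\<lambda>i y. s i y \<rho>) (k \<rho>))"
proof -
  obtain rb nb where rb: "\<And>\<rho> m. m \<ge> nb \<Longrightarrow> computes rb (map \<rho> [0..<m]) (b \<rho>)"
    using b unfolding computable_def by blast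
  obtain rs ns where rs: "\<And>\<rho> m. m \<ge> ns \<Longrightarrow> computes rs (map \<rho> [0..<m])
      (s (\<rho> 0) (\<rho> (Suc 0)) (\<lambda>i. \<rho> (Suc (Suc i))))"
    using s unfolding computable_def by blast
  obtain rk nk where rk: "\<And>\<rho> m. m \<ge> nk \<Longrightarrow> computes rk (map \<rho> [0..<m]) (k \<rho>)"
    using k unfolding computable_def by blast
  \<comment> \<open>The recursion runs on a fixed prefix of \<open>N\<close> parameters, long enough
    for base and step; projections later cut longer inputs down to it.\<close>
  define N where "N = nb + ns"
  have *: "computes (PrimRec rb rs) (i # map \<rho> [0..<N]) (rec_nat (b \<rho>) (\<lambda>i y. s i y \<rho>) i)" for \<rho> i
  proof (induction i)
    case 0
    show ?case using rb[of N \<rho>] by (auto intro: rec_0 simp: N_def)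
  next
    case (Suc i)
    let ?y = "rec_nat (b \<rho>) (\<lambda>i y. s i y \<rho>) i"
    have "computes rs (i # ?y # map \<rho> [0..<N]) (s i ?y \<rho>)"
      using rs[of "Suc (Suc N)" "case_nat i (case_nat ?y \<rho>)"]
      unfolding map_upt_Cons by (simp add: N_def del: upt_Suc)
    from rec_Suc[OF Suc this] show ?case by simp
  qed
  have "computes (Comp (PrimRec rb rs) (rk # map Proj [0..<N])) (map \<rho> [0..<m])
      (rec_nat (b \<rho>) (\<lambda>i y. s i y \<rho>) (k \<rho>))" if m: "m \<ge> N + nk" for \<rho> m
  proof (rule comp)
    show "computes (PrimRec rb rs) (k \<rho> # map \<rho> [0..<N]) (rec_nat (b \<rho>) (\<lambda>i y. s i y \<rho>) (k \<rho>))"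
      by (rule *)
    have "computes (Proj i) (map \<rho> [0..<m]) (\<rho> i)" if "i < N" for i
      using proj[of i "map \<rho> [0..<m]"] that m by simp
    then show "list_all2 (\<lambda>g y. computes g (map \<rho> [0..<m]) y) (rk # map Proj [0..<N])
        (k \<rho> # map \<rho> [0..<N])"
      using rk m by (simp add: list_all2_conv_all_nth[of _ "map Proj _"])
  qed
  then show ?thesis unfolding computable_def by blast
qed

lemma computable_Least [computable_intros]:
  assumes P: "decidable (\<lambda>\<rho>. P (\<rho> 0) (\<lambda>i. \<rho> (Suc i)))" and ex: "\<And>\<rho>. \<exists>a. P a \<rho>"
  shows "computable (\<lambda>\<rho>. LEAST a. P a \<rho>)"
proof -
  let ?t = "\<lambda>\<rho>. if P (\<rho> 0) (\<lambda>i. \<rho> (Suc i)) then 1 else 0 :: nat"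
  \<comment> \<open>\<open>Mu\<close> searches for the value 0, so truth values are flipped; this
    recursion sends 0 to 1 and everything else to 0.\<close>
  have "computable (\<lambda>\<rho>. rec_nat 1 (\<lambda>i y. 0) (\<rho> 0))"
    by (intro computable_intros)
  from computable_comp1[OF this P[unfolded decidable_def]]
  obtain r n where r: "\<And>\<rho> m. m \<ge> n \<Longrightarrow> computes r (map \<rho> [0..<m]) (rec_nat 1 (\<lambda>i y. 0) (?t \<rho>))"
    unfolding computable_def by blast
  have "computes (Mu r) (map \<rho> [0..<m]) (LEAST a. P a \<rho>)" if m: "m \<ge> n" for \<rho> m
  proof -
    have v: "computes r (a # map \<rho> [0..<m]) (if P a \<rho> then 0 else 1)" for a
      using r[of "Suc m" "case_nat a \<rho>"] m unfolding map_upt_Cons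
      by (simp del: upt_Suc split: if_splits)
    show ?thesis
    proof (rule mu)
      show "computes r ((LEAST a. P a \<rho>) # map \<rho> [0..<m]) 0"
        using v[of "LEAST a. P a \<rho>"] LeastI_ex[OF ex[of \<rho>]] by simp
      show "\<forall>a<LEAST a. P a \<rho>. \<exists>v. computes r (a # map \<rho> [0..<m]) (Suc v)"
        using v not_less_Least by (metis One_nat_def)
    qed
  qed
  then show ?thesis unfolding computable_def by blast
qed

section \<open>Arithmetic, connectives and bounded quantifiers\<close>

lemma computable_add [computable_intros]:
  assumes "computable f" "computable g" shows "computable (\<lambda>\<rho>. f \<rho> + g \<rho>)"
proof -
  have "a + b = rec_nat a (\<lambda>_ y. Suc y) b" for a b :: nat by (induction b) auto
  then show ?thesis by (simp only:) (intro computable_intros assms)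
qed

lemma computable_mult [computable_intros]:
  assumes "computable f" "computable g" shows "computable (\<lambda>\<rho>. f \<rho> * g \<rho>)"
proof -
  have *: "a * b = rec_nat 0 (\<lambda>_ y. y + a) b" for a b :: nat by (induction b) auto
  have "computable (\<lambda>\<rho>. \<rho> 0 * \<rho> 1)" unfolding * by (intro computable_intros)
  from computable_comp2[OF this assms] show ?thesis .
qed

lemma computable_diff [computable_intros]:
  assumes "computable f" "computable g" shows "computable (\<lambda>\<rho>. f \<rho> - g \<rho>)"
proof -
  have p: "rec_nat 0 (\<lambda>i _. i) a = a - 1" for a :: nat by (cases a) auto
  have *: "a - b = rec_nat a (\<lambda>_ y. rec_nat 0 (\<lambda>i _. i) y) b" for a b :: nat
    by (induction b) (auto simp: p)
  have "computable (\<lambda>\<rho>. \<rho> 0 - \<rho> 1)" unfolding * by (intro computable_intros)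
  from computable_comp2[OF this assms] show ?thesis .
qed

lemma computable_power [computable_intros]:
  assumes "computable f" "computable g" shows "computable (\<lambda>\<rho>. f \<rho> ^ g \<rho>)"
proof -
  have *: "a ^ b = rec_nat 1 (\<lambda>_ y. a * y) b" for a b :: nat by (induction b) auto
  have "computable (\<lambda>\<rho>. \<rho> 0 ^ \<rho> 1)" unfolding * by (intro computable_intros)
  from computable_comp2[OF this assms] show ?thesis .
qed

lemma computable_fact [computable_intros]:
  assumes "computable f" shows "computable (\<lambda>\<rho>. fact (f \<rho>))"
proof -
  have *: "fact a = rec_nat 1 (\<lambda>i y. Suc i * y) a" for a :: nat by (induction a) auto
  have "computable (\<lambda>\<rho>. fact (\<rho> 0))" unfolding * by (intro computable_intros)
  from computable_comp1[OF this assms] show ?thesis .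
qed

lemma computable_if [computable_intros]:
  assumes "decidable P" "computable f" "computable g"
  shows "computable (\<lambda>\<rho>. if P \<rho> then f \<rho> else g \<rho>)"
proof -
  let ?t = "\<lambda>\<rho>. if P \<rho> then 1 else 0 :: nat"
  have "computable (\<lambda>\<rho>. ?t \<rho> * f \<rho> + (1 - ?t \<rho>) * g \<rho>)"
    using assms(1)[unfolded decidable_def] by (intro computable_intros assms)
  moreover have "(\<lambda>\<rho>. ?t \<rho> * f \<rho> + (1 - ?t \<rho>) * g \<rho>) = (\<lambda>\<rho>. if P \<rho> then f \<rho> else g \<rho>)"
    by auto
  ultimately show ?thesis by simp
qed

lemma decidable_not [computable_intros]: "decidable P \<Longrightarrow> decidable (\<lambda>\<rho>. \<not> P \<rho>)"
proof -
  assume "decidable P"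
  then have "computable (\<lambda>\<rho>. if P \<rho> then 0 else 1)" by (intro computable_intros)
  moreover have "(\<lambda>\<rho>. if P \<rho> then 0 else 1) = (\<lambda>\<rho>. if \<not> P \<rho> then 1 else 0 :: nat)" by auto
  ultimately show ?thesis unfolding decidable_def by simp
qed

lemma decidable_conj [computable_intros]:
  assumes "decidable P" "decidable Q" shows "decidable (\<lambda>\<rho>. P \<rho> \<and> Q \<rho>)"
proof -
  have "computable (\<lambda>\<rho>. if P \<rho> then if Q \<rho> then 1 else 0 else 0)"
    by (intro computable_intros assms)
  moreover have "(\<lambda>\<rho>. if P \<rho> then if Q \<rho> then 1 else 0 else 0)
    = (\<lambda>\<rho>. if P \<rho> \<and> Q \<rho> then 1 else 0 :: nat)" by auto
  ultimately show ?thesis unfolding decidable_def by simp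
qed

lemma decidable_disj [computable_intros]:
  assumes "decidable P" "decidable Q" shows "decidable (\<lambda>\<rho>. P \<rho> \<or> Q \<rho>)"
proof -
  have "decidable (\<lambda>\<rho>. \<not> (\<not> P \<rho> \<and> \<not> Q \<rho>))" by (intro computable_intros assms)
  then show ?thesis by simp
qed

lemma decidable_imp [computable_intros]:
  assumes "decidable P" "decidable Q" shows "decidable (\<lambda>\<rho>. P \<rho> \<longrightarrow> Q \<rho>)"
proof -
  have "decidable (\<lambda>\<rho>. \<not> P \<rho> \<or> Q \<rho>)" by (intro computable_intros assms)
  then show ?thesis by (simp only: imp_conv_disj)
qed

lemma decidable_const [computable_intros]: "decidable (\<lambda>\<rho>. b)"
  unfolding decidable_def by (rule computable_const)

lemma decidable_le [computable_intros]:
  assumes "computable f" "computable g" shows "decidable (\<lambda>\<rho>. f \<rho> \<le> g \<rho>)"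
proof -
  have "computable (\<lambda>\<rho>. 1 - (f \<rho> - g \<rho>))" by (intro computable_intros assms)
  moreover have "(\<lambda>\<rho>. 1 - (f \<rho> - g \<rho>)) = (\<lambda>\<rho>. if f \<rho> \<le> g \<rho> then 1 else 0)" by fastforce
  ultimately show ?thesis unfolding decidable_def by (simp only:)
qed

lemma decidable_less [computable_intros]:
  assumes "computable f" "computable g" shows "decidable (\<lambda>\<rho>. f \<rho> < g \<rho>)"
  unfolding not_le[symmetric] by (intro computable_intros assms)

lemma decidable_eq [computable_intros]:
  assumes "computable f" "computable g" shows "decidable (\<lambda>\<rho>. f \<rho> = g \<rho>)"
  unfolding order.eq_iff by (intro computable_intros assms)

lemma decidable_ball [computable_intros]:
  assumes b: "computable b" and P: "decidable (\<lambda>\<rho>. P (\<rho> 0) (\<lambda>i. \<rho> (Suc i)))"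
  shows "decidable (\<lambda>\<rho>. \<forall>a\<le>b \<rho>. P a \<rho>)"
proof -
  have "computable (\<lambda>\<rho>. if P (\<rho> 0) (\<lambda>i. \<rho> (Suc i)) then 1 else 0)"
    using P unfolding decidable_def .
  \<comment> \<open>In the recursion below, index 1 holds the accumulated truth value, which
    \<open>P\<close> has to skip.\<close>
  from computable_subst[OF this, of "\<lambda>i. case i of 0 \<Rightarrow> \<lambda>\<rho>. \<rho> 0 | Suc i \<Rightarrow> \<lambda>\<rho>. \<rho> (Suc (Suc i))"]
  have "decidable (\<lambda>\<rho>. P (\<rho> 0) (\<lambda>i. \<rho> (Suc (Suc i))))"
    by (simp add: decidable_def computable_var split: nat.split)
  then have "computable (\<lambda>\<rho>. rec_nat 1 (\<lambda>i y. if P i \<rho> then y else 0) (Suc (b \<rho>)))"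
    by (intro computable_intros b)
  moreover have "rec_nat 1 (\<lambda>i y. if P i \<rho> then y else 0) k = (if \<forall>a<k. P a \<rho> then 1 else 0 :: nat)" for k \<rho>
    by (induction k) (auto simp: less_Suc_eq)
  ultimately show ?thesis unfolding decidable_def by (simp only: less_Suc_eq_le)
qed

lemma decidable_bex [computable_intros]:
  assumes "computable b" "decidable (\<lambda>\<rho>. P (\<rho> 0) (\<lambda>i. \<rho> (Suc i)))"
  shows "decidable (\<lambda>\<rho>. \<exists>a\<le>b \<rho>. P a \<rho>)"
proof -
  have "decidable (\<lambda>\<rho>. \<not> (\<forall>a\<le>b \<rho>. \<not> P a \<rho>))" by (intro computable_intros assms)
  then show ?thesis by simp
qed

lemma computable_div [computable_intros]:
  assumes "computable f" "computable g" shows "computable (\<lambda>\<rho>. f \<rho> div g \<rho>)"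
proof -
  \<comment> \<open>The disjunct \<open>b = 0\<close> stops the search at 0, the value of
    \<open>a div 0\<close>.\<close>
  have *: "a div b = (LEAST q. b = 0 \<or> a < b * Suc q)" for a b :: nat
  proof (rule Least_equality[symmetric])
    show "b = 0 \<or> a < b * Suc (a div b)" using dividend_less_times_div[of b a] by auto
    fix q assume "b = 0 \<or> a < b * Suc q"
    then show "a div b \<le> q" using div_le_mono
      by (metis bot_nat_0.extremum div_by_0 less_Suc_eq_le less_mult_imp_div_less mult.commute)
  qed
  have ex: "\<exists>q. b = 0 \<or> a < b * Suc q" for a b :: nat
    using dividend_less_times_div[of b a] by (auto intro: exI[of _ "a div b"])
  have "computable (\<lambda>\<rho>. \<rho> 0 div \<rho> 1)" unfolding * by (intro computable_intros ex)
  from computable_comp2[OF this assms] show ?thesis .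
qed

section \<open>Pairing and finite sets of numbers\<close>

lemma prod_encode_le: "i \<le> prod_encode (i, j)" "j \<le> prod_encode (i, j)"
  by (rule le_prod_encode_1, rule le_prod_encode_2)

lemma computable_prod_encode [computable_intros]:
  assumes "computable f" "computable g" shows "computable (\<lambda>\<rho>. prod_encode (f \<rho>, g \<rho>))"
  unfolding prod_encode_def prod.case triangle_def by (intro computable_intros assms)

definition pfst :: "nat \<Rightarrow> nat" where "pfst c = fst (prod_decode c)"
definition psnd :: "nat \<Rightarrow> nat" where "psnd c = snd (prod_decode c)"

lemma pfst_encode [simp]: "pfst (prod_encode (i, j)) = i"
  and psnd_encode [simp]: "psnd (prod_encode (i, j)) = j"
  by (simp_all add: pfst_def psnd_def)

lemma prod_encode_pfst_psnd [simp]: "prod_encode (pfst c, psnd c) = c"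
  by (simp add: pfst_def psnd_def)

lemma pfst_le: "pfst c \<le> c" and psnd_le: "psnd c \<le> c"
  using prod_encode_le[where i = "pfst c" and j = "psnd c"] by simp_all

lemma add_le_prod_encode: "i + j \<le> prod_encode (i, j)"
proof -
  have "n \<le> triangle n" for n by (induction n) auto
  then show ?thesis unfolding prod_encode_def prod.case by (meson trans_le_add1)
qed

text \<open>This is what makes decoding terminate: constructors with recursive arguments have tag at
  least 2, while for tag 0 a code may equal its own second component.\<close>

lemma psnd_less: "pfst c \<noteq> 0 \<Longrightarrow> psnd c < c"
  using add_le_prod_encode[of "pfst c" "psnd c"] by simp

lemma pfst_psnd_less: "pfst c \<noteq> 0 \<Longrightarrow> pfst (psnd c) < c"
  and psnd_psnd_less: "pfst c \<noteq> 0 \<Longrightarrow> psnd (psnd c) < c"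
  using psnd_less[of c] pfst_le[of "psnd c"] psnd_le[of "psnd c"] by simp_all

lemma computable_pfst [computable_intros]:
  assumes "computable f" shows "computable (\<lambda>\<rho>. pfst (f \<rho>))"
proof -
  have *: "pfst c = (LEAST i. \<exists>j\<le>c. prod_encode (i, j) = c)" for c
    by (rule Least_equality[symmetric]) (auto intro: exI[of _ "psnd c"] simp: psnd_le)
  have ex: "\<exists>i. \<exists>j\<le>c. prod_encode (i, j) = c" for c using psnd_le by (metis prod_encode_pfst_psnd)
  have "computable (\<lambda>\<rho>. pfst (\<rho> 0))" unfolding * by (intro computable_intros ex)
  from computable_comp1[OF this assms] show ?thesis .
qed

lemma computable_psnd [computable_intros]:
  assumes "computable f" shows "computable (\<lambda>\<rho>. psnd (f \<rho>))"
proof -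
  have *: "psnd c = (LEAST j. prod_encode (pfst c, j) = c)" for c
    by (rule Least_equality[symmetric]) (auto, metis order_refl psnd_encode)
  have ex: "\<exists>j. prod_encode (pfst c, j) = c" for c by (metis prod_encode_pfst_psnd)
  have "computable (\<lambda>\<rho>. psnd (\<rho> 0))" unfolding * by (intro computable_intros ex)
  from computable_comp1[OF this assms] show ?thesis .
qed

lemma decidable_set_decode [computable_intros]:
  assumes "computable f" "computable g" shows "decidable (\<lambda>\<rho>. f \<rho> \<in> set_decode (g \<rho>))"
proof -
  have "odd y \<longleftrightarrow> y = Suc (2 * (y div 2))" for y :: nat by presburger
  then have *: "x \<in> set_decode S \<longleftrightarrow> S div 2 ^ x = Suc (2 * (S div 2 ^ x div 2))" for x S
    unfolding set_decode_def mem_Collect_eq .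
  show ?thesis unfolding * by (intro computable_intros assms)
qed

text \<open>\<open>decidable\<close> speaks of long prefixes, \<open>recursive_set\<close> of a
  single argument; the gap is closed by feeding \<open>Suc n\<close> copies of the argument, a
  prefix of a constant environment.\<close>

lemma recursive_set_decidable:
  assumes "decidable (\<lambda>\<rho>. \<rho> 0 \<in> A)" shows "recursive_set A"
proof -
  obtain r n where r: "\<And>\<rho> m. m \<ge> n \<Longrightarrow> computes r (map \<rho> [0..<m]) (if \<rho> 0 \<in> A then 1 else 0)"
    using assms unfolding decidable_def computable_def by blast
  have "computes (Comp r (map (\<lambda>i. Proj 0) [0..<Suc n])) [x] (if x \<in> A then 1 else 0)" for x
  proof (rule comp)
    show "computes r (map (\<lambda>i. x) [0..<Suc n]) (if x \<in> A then 1 else 0)"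
      by (rule r) simp
    show "list_all2 (\<lambda>g y. computes g [x] y) (map (\<lambda>i. Proj 0) [0..<Suc n]) (map (\<lambda>i. x) [0..<Suc n])"
      using proj[of 0 "[x]"] by (auto simp: list_all2_conv_all_nth simp del: upt_Suc)
  qed
  then show ?thesis unfolding recursive_set_def by blast
qed

section \<open>Course-of-values recursion through finite tables\<close>

text \<open>\<open>S\<close> codes a finite table of a binary function: \<open>entry S c e v\<close> says that it lists \<open>v\<close> as the
  value at \<open>(c, e)\<close>.\<close>

definition entry :: "nat \<Rightarrow> nat \<Rightarrow> nat \<Rightarrow> nat \<Rightarrow> bool" where
  "entry S c e v \<longleftrightarrow> prod_encode (c, prod_encode (e, v)) \<in> set_decode S"

lemma decidable_entry [computable_intros]:
  assumes "computable s" "computable c" "computable e" "computable v"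
  shows "decidable (\<lambda>\<rho>. entry (s \<rho>) (c \<rho>) (e \<rho>) (v \<rho>))"
  unfolding entry_def by (intro computable_intros assms)

lemma set_decode_le: "x \<in> set_decode S \<Longrightarrow> x \<le> S"
proof -
  assume "x \<in> set_decode S"
  then have "S div 2 ^ x \<noteq> 0" unfolding set_decode_def by (metis mem_Collect_eq even_zero)
  then have "2 ^ x \<le> S" by (simp add: div_eq_0_iff)
  then show ?thesis using less_exp[of x] by linarith
qed

lemma entry_le: "entry S c e v \<Longrightarrow> c \<le> S \<and> e \<le> S \<and> v \<le> S"
  unfolding entry_def using set_decode_le prod_encode_le by (meson order_trans)

text \<open>Recursion on \<open>c\<close> in which \<open>e\<close> may change: search for a table all of whose entries pass the local
  check \<open>C\<close>, and read off the value.\<close>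

lemma computable_by_table:
  assumes C: "decidable (\<lambda>\<rho>. C (\<rho> 0) (\<rho> 1) (\<rho> 2) (\<rho> 3))"
    and sound: "\<And>S c e v. (\<And>c' e' v'. entry S c' e' v' \<Longrightarrow> c' < c \<Longrightarrow> v' = f c' e') \<Longrightarrow>
      C S c e v \<Longrightarrow> v = f c e"
    and complete: "\<And>c e. \<exists>D. finite D \<and> (\<forall>(c', e')\<in>D. c' < c) \<and>
      (\<forall>S. (\<forall>(c', e')\<in>D. entry S c' e' (f c' e')) \<longrightarrow>
        (\<forall>c' e' v'. entry S c' e' v' \<longrightarrow> v' = f c' e') \<longrightarrow> C S c e (f c e))"
  shows "computable (\<lambda>\<rho>. f (\<rho> 0) (\<rho> 1))"
proof -
  \<comment> \<open>Bounding by \<open>S\<close> loses no entry, because a table is at least as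
    large as every number it lists; it makes validity decidable.\<close>
  define valid where "valid S \<longleftrightarrow> (\<forall>c\<le>S. \<forall>e\<le>S. \<forall>v\<le>S. entry S c e v \<longrightarrow> C S c e v)" for S
  have correct: "v = f c e" if "valid S" "entry S c e v" for S c e v
    using that(2)
  proof (induction c arbitrary: e v rule: less_induct)
    case (less c)
    then have "C S c e v" using that(1) entry_le unfolding valid_def by blast
    then show ?case using sound less.IH by blast
  qed
  define Q where "Q c e D \<longleftrightarrow> finite D \<and> (\<forall>(c', e')\<in>D. c' < c) \<and>
    (\<forall>S. (\<forall>(c', e')\<in>D. entry S c' e' (f c' e')) \<longrightarrow>
      (\<forall>c' e' v'. entry S c' e' v' \<longrightarrow> v' = f c' e') \<longrightarrow> C S c e (f c e))" for c e D
  have "\<forall>c e. \<exists>D. Q c e D" using complete unfolding Q_def by blast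
  then obtain D where "\<And>c e. Q c e (D c e)" by metis
  then have D: "\<And>c e. finite (D c e)" "\<And>c e c' e'. (c', e') \<in> D c e \<Longrightarrow> c' < c"
    "\<And>c e S. (\<forall>(c', e')\<in>D c e. entry S c' e' (f c' e')) \<Longrightarrow>
        (\<forall>c' e' v'. entry S c' e' v' \<longrightarrow> v' = f c' e') \<Longrightarrow> C S c e (f c e)"
    unfolding Q_def by blast+
  \<comment> \<open>Each point has finitely many dependencies, all with smaller first component, so
    their closure is finite. Its graph is the table that the search finds at the latest.\<close>
  have closed: "\<exists>X. finite X \<and> (c, e) \<in> X \<and> (\<forall>(c', e')\<in>X. D c' e' \<subseteq> X)" for c e
  proof (induction c arbitrary: e rule: less_induct)
    case (less c)
    then have "\<forall>p\<in>D c e. \<exists>X. finite X \<and> p \<in> X \<and> (\<forall>(c', e')\<in>X. D c' e' \<subseteq> X)"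
      using D(2) by force
    from bchoice[OF this] obtain Y where Y: "\<forall>p\<in>D c e. finite (Y p) \<and> p \<in> Y p \<and> (\<forall>(c', e')\<in>Y p. D c' e' \<subseteq> Y p)"
      by blast
    show ?case
      by (rule exI[of _ "insert (c, e) (\<Union>p\<in>D c e. Y p)"]) (use Y D(1) in fastforce)
  qed
  have ex: "\<exists>S. valid S \<and> (\<exists>v\<le>S. entry S c e v)" for c e
  proof -
    obtain X where X: "finite X" "(c, e) \<in> X" "\<And>c' e'. (c', e') \<in> X \<Longrightarrow> D c' e' \<subseteq> X"
      using closed[of c e] by blast
    define S where "S = set_encode ((\<lambda>(c, e). prod_encode (c, prod_encode (e, f c e))) ` X)"
    have S: "entry S c e v \<longleftrightarrow> (c, e) \<in> X \<and> v = f c e" for c e v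
      unfolding entry_def S_def using X(1) by (force simp: image_iff prod_encode_eq)
    have "C S c e v" if "entry S c e v" for c e v
      using that D(3)[of c e S] X(3) unfolding S by auto
    then show ?thesis using X(2) S entry_le unfolding valid_def by blast
  qed
  define T where "T c e = (LEAST S. valid S \<and> (\<exists>v\<le>S. entry S c e v))" for c e
  have T: "valid (T c e) \<and> (\<exists>v\<le>T c e. entry (T c e) c e v)" for c e
    unfolding T_def by (rule LeastI_ex[OF ex])
  \<comment> \<open>Minimisation merely reads the value off: in a valid table \<open>f c e\<close>
    is the only value listed at \<open>(c, e)\<close>.\<close>
  have fT: "f c e = (LEAST v. entry (T c e) c e v)" for c e
    by (rule Least_equality[symmetric]) (use T correct in blast)+
  have "computable (\<lambda>\<rho>. T (\<rho> 0) (\<rho> 1))"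
    unfolding T_def valid_def by (intro computable_intros decidable_comp4[OF C] ex[unfolded valid_def])
  note computable_T = computable_comp2[OF this]
  show ?thesis unfolding fT using T by (intro computable_intros computable_T) blast
qed

section \<open>Environments as numbers\<close>

text \<open>An environment is coded by iterated pairing; \<open>0\<close> means unassigned and \<open>Suc a\<close> means \<open>a\<close>.\<close>

primrec lookup :: "nat \<Rightarrow> nat \<Rightarrow> nat" where
  "lookup e 0 = pfst e"
| "lookup e (Suc y) = lookup (psnd e) y"

primrec update :: "nat \<Rightarrow> nat \<Rightarrow> nat \<Rightarrow> nat" where
  "update e 0 a = prod_encode (Suc a, psnd e)"
| "update e (Suc x) a = prod_encode (pfst e, update (psnd e) x a)"

lemma lookup_update: "lookup (update e x a) y = (if y = x then Suc a else lookup e y)"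
proof (induction x arbitrary: e y)
  case 0
  then show ?case by (cases y) auto
next
  case (Suc x)
  then show ?case by (cases y) auto
qed

text \<open>Every assigned value is bounded by the code itself, so quantifier bounds can be computed
  from \<open>e\<close> alone.\<close>

lemma lookup_le: "lookup e y \<le> e"
proof (induction y arbitrary: e)
  case 0
  then show ?case by (simp add: pfst_le)
next
  case (Suc y)
  then show ?case using psnd_le[of e] order_trans by (metis lookup.simps(2))
qed

text \<open>Hence 0 codes the empty environment, the one in which sentences are evaluated.\<close>

lemma lookup_0 [simp]: "lookup 0 y = 0"
  using lookup_le[of 0 y] by simp

lemma computable_lookup [computable_intros]:
  assumes "computable f" "computable g"
  shows "computable (\<lambda>\<rho>. lookup (f \<rho>) (g \<rho>))"
proof -
  have *: "lookup e y = pfst (rec_nat e (\<lambda>_ t. psnd t) y)" for e y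
  proof (induction y arbitrary: e)
    case (Suc y)
    have "psnd (rec_nat e (\<lambda>_ t. psnd t) y) = rec_nat (psnd e) (\<lambda>_ t. psnd t) y" for e
      by (induction y) auto
    then show ?case using Suc by simp
  qed simp
  have "computable (\<lambda>\<rho>. lookup (\<rho> 0) (\<rho> 1))" unfolding * by (intro computable_intros)
  from computable_comp2[OF this assms] show ?thesis .
qed

lemma computable_update [computable_intros]:
  assumes "computable f" "computable g" "computable h"
  shows "computable (\<lambda>\<rho>. update (f \<rho>) (g \<rho>) (h \<rho>))"
proof -
  define tail where "tail e y = rec_nat e (\<lambda>_ t. psnd t) y" for e y
  have "computable (\<lambda>\<rho>. tail (\<rho> 0) (\<rho> 1))" unfolding tail_def by (intro computable_intros)
  note computable_tail = computable_comp2[OF this]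
  \<comment> \<open>\<open>update\<close> descends to position \<open>x\<close>, whereas primitive
    recursion works outwards: after \<open>j\<close> steps \<open>r\<close> is the updated tail that
    starts at position \<open>x - j\<close>.\<close>
  define r where "r e x a = rec_nat (prod_encode (Suc a, psnd (tail e x)))
    (\<lambda>i t. prod_encode (pfst (tail e (x - Suc i)), t))" for e x a
  have r: "j \<le> x \<Longrightarrow> r e x a j = update (tail e (x - j)) j a" for e x a j
  proof (induction j)
    case 0
    then show ?case by (simp add: r_def)
  next
    case (Suc j)
    then have "psnd (tail e (x - Suc j)) = tail e (x - j)"
      by (simp add: tail_def Suc_diff_Suc[symmetric])
    with Suc show ?case by (simp add: r_def)
  qed
  have *: "update e x a = r e x a x" for e x a
    using r[of x x e a] by (simp add: tail_def)
  have "computable (\<lambda>\<rho>. update (\<rho> 0) (\<rho> 1) (\<rho> 2))"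
    unfolding * r_def by (intro computable_intros computable_tail)
  from computable_comp3[OF this assms] show ?thesis .
qed

section \<open>Evaluation of formulas with bounded quantifiers\<close>

text \<open>An unassigned variable gets the value \<open>d 0\<close>, since \<open>0 - 1 = 0\<close>
  on the naturals.\<close>

definition env :: "(nat \<Rightarrow> 'a) \<Rightarrow> nat \<Rightarrow> nat \<Rightarrow> 'a" where
  "env d e = (\<lambda>y. d (lookup e y - 1))"

definition env_dom :: "nat \<Rightarrow> nat set" where
  "env_dom e = {y. lookup e y \<noteq> 0}"

lemma env_update: "env d (update e x k) = (env d e)(x := d k)"
  by (auto simp: env_def lookup_update)

lemma env_dom_update: "env_dom (update e x k) = insert x (env_dom e)"
  by (auto simp: env_dom_def lookup_update)

lemma val_cong: "(\<And>y. y \<in> fv_trm t \<Longrightarrow> e y = e' y) \<Longrightarrow> val M e t = val M e' t"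
  by (induction t) auto

lemma sat_cong: "(\<And>y. y \<in> fv \<phi> \<Longrightarrow> e y = e' y) \<Longrightarrow> sat M e \<phi> \<longleftrightarrow> sat M e' \<phi>"
proof (induction \<phi> arbitrary: e e')
  case (All x \<phi>)
  have "sat M (e(x := a)) \<phi> \<longleftrightarrow> sat M (e'(x := a)) \<phi>" for a
    by (rule All.IH) (use All.prems in auto)
  then show ?case by simp
next
  case (Eq s t)
  then have "val M e s = val M e' s" "val M e t = val M e' t" by (auto intro: val_cong)
  then show ?case by simp
next
  case (Sub s t)
  then have "val M e s = val M e' s" "val M e t = val M e' t" by (auto intro: val_cong)
  then show ?case by simp
next
  case (Neg \<phi>)
  from Neg.IH[of e e'] Neg.prems show ?case by simp
next
  case (Imp \<phi> \<psi>)
  from Imp.IH(1)[of e e'] Imp.IH(2)[of e e'] Imp.prems show ?case by simp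
qed

lemma sentence_sat: "sentence \<phi> \<Longrightarrow> sat M e \<phi> \<longleftrightarrow> M \<Turnstile> \<phi>"
  unfolding models_def sentence_def using sat_cong[of \<phi>] by blast

text \<open>Numbers name elements through \<open>d\<close>, possibly many numbers for one element,
  so equality of elements is a predicate \<open>eqp\<close> of its own.
  \<open>bounded_witness\<close> states that a universal quantifier need only be tested on names up
  to \<open>G\<close>.\<close>

locale coded_struct =
  fixes M :: "'a lstruct" and d :: "nat \<Rightarrow> 'a"
    and emp :: nat and sing :: "nat \<Rightarrow> nat" and uni :: "nat \<Rightarrow> nat \<Rightarrow> nat"
    and eqp subp :: "nat \<Rightarrow> nat \<Rightarrow> bool" and G :: "nat \<Rightarrow> nat \<Rightarrow> nat"
  assumes d_emp: "d emp = emp_of M" and d_sing: "d (sing k) = sing_of M (d k)"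
    and d_uni: "d (uni k l) = uni_of M (d k) (d l)"
    and eqp: "eqp k l \<longleftrightarrow> d k = d l" and subp: "subp k l \<longleftrightarrow> sub_of M (d k) (d l)"
    and computable_sing: "computable (\<lambda>\<rho>. sing (\<rho> 0))"
    and computable_uni: "computable (\<lambda>\<rho>. uni (\<rho> 0) (\<rho> 1))"
    and decidable_eqp: "decidable (\<lambda>\<rho>. eqp (\<rho> 0) (\<rho> 1))"
    and decidable_subp: "decidable (\<lambda>\<rho>. subp (\<rho> 0) (\<rho> 1))"
    and computable_G: "computable (\<lambda>\<rho>. G (\<rho> 0) (\<rho> 1))"
    and bounded_witness: "(\<And>k. k \<le> G (fm_code (\<^bold>\<forall>x. \<phi>)) e \<Longrightarrow> sat M ((env d e)(x := d k)) \<phi>) \<Longrightarrow>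
      sat M ((env d e)(x := a)) \<phi>"
begin

lemmas computable_ops = computable_comp1[OF computable_sing] computable_comp2[OF computable_uni]
  decidable_comp2[OF decidable_eqp] decidable_comp2[OF decidable_subp]
  computable_comp2[OF computable_G]

text \<open>Value \<open>0\<close> signals an error: an unassigned variable or a number that codes no term.\<close>

function eval_trm :: "nat \<Rightarrow> nat \<Rightarrow> nat" where
  "eval_trm c e =
    (if pfst c = 0 then lookup e (psnd c)
     else if pfst c = 1 then (if psnd c = 0 then Suc emp else 0)
     else if pfst c = 2 then
       (if eval_trm (psnd c) e = 0 then 0 else Suc (sing (eval_trm (psnd c) e - 1)))
     else if pfst c = 3 then
       (if eval_trm (pfst (psnd c)) e = 0 \<or> eval_trm (psnd (psnd c)) e = 0 then 0
        else Suc (uni (eval_trm (pfst (psnd c)) e - 1) (eval_trm (psnd (psnd c)) e - 1)))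
     else 0)"
  by auto
termination
  by (relation "measure fst") (auto intro: psnd_less pfst_psnd_less psnd_psnd_less)

declare eval_trm.simps [simp del]

lemma computable_eval_trm: "computable (\<lambda>\<rho>. eval_trm (\<rho> 0) (\<rho> 1))"
proof (rule computable_by_table)
  let ?C = "\<lambda>S c e v. (pfst c = 0 \<and> v = lookup e (psnd c)) \<or>
    (pfst c = 1 \<and> v = (if psnd c = 0 then Suc emp else 0)) \<or>
    (pfst c = 2 \<and> (\<exists>w\<le>S. entry S (psnd c) e w \<and> v = (if w = 0 then 0 else Suc (sing (w - 1))))) \<or>
    (pfst c = 3 \<and> (\<exists>w\<le>S. \<exists>w'\<le>S. entry S (pfst (psnd c)) e w \<and> entry S (psnd (psnd c)) e w' \<and>
      v = (if w = 0 \<or> w' = 0 then 0 else Suc (uni (w - 1) (w' - 1))))) \<or>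
    (3 < pfst c \<and> v = 0)"
  show "decidable (\<lambda>\<rho>. ?C (\<rho> 0) (\<rho> 1) (\<rho> 2) (\<rho> 3))"
    by (intro computable_intros computable_ops)
  show "v = eval_trm c e" if entry: "\<And>c' e' v'. entry S c' e' v' \<Longrightarrow> c' < c \<Longrightarrow> v' = eval_trm c' e'"
    and C: "?C S c e v" for S c e v
  proof -
    have less: "psnd c < c" "pfst (psnd c) < c" "psnd (psnd c) < c" if "pfst c \<noteq> 0"
      using that psnd_less pfst_psnd_less psnd_psnd_less by simp_all
    show ?thesis
      using C by (elim disjE conjE exE) (use entry less in \<open>simp_all add: eval_trm.simps[of c]\<close>)
  qed
  show "\<exists>D. finite D \<and> (\<forall>(c', e')\<in>D. c' < c) \<and>
      (\<forall>S. (\<forall>(c', e')\<in>D. entry S c' e' (eval_trm c' e')) \<longrightarrow>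
        (\<forall>c' e' v'. entry S c' e' v' \<longrightarrow> v' = eval_trm c' e') \<longrightarrow> ?C S c e (eval_trm c e))" for c e
  proof -
    \<comment> \<open>One set of dependencies serves all tags. Tag 0 is kept apart because there the
      components need not be smaller than \<open>c\<close>.\<close>
    let ?D = "if pfst c = 0 then {} else {(psnd c, e), (pfst (psnd c), e), (psnd (psnd c), e)}"
    have "\<forall>(c', e')\<in>?D. c' < c"
      using psnd_less[of c] pfst_psnd_less[of c] psnd_psnd_less[of c] by auto
    moreover have "?C S c e (eval_trm c e)" if "\<forall>(c', e')\<in>?D. entry S c' e' (eval_trm c' e')" for S
    proof -
      consider "pfst c = 0" | "pfst c = 1" | "pfst c = 2" | "pfst c = 3" | "pfst c > 3" by linarith
      then show ?thesis
      proof cases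
        case 3
        with that have "entry S (psnd c) e (eval_trm (psnd c) e)" by simp
        with 3 entry_le[OF this] show ?thesis by (auto simp: eval_trm.simps[of c])
      next
        case 4
        with that have *: "entry S (pfst (psnd c)) e (eval_trm (pfst (psnd c)) e)"
          "entry S (psnd (psnd c)) e (eval_trm (psnd (psnd c)) e)" by simp_all
        have "\<exists>w\<le>S. \<exists>w'\<le>S. entry S (pfst (psnd c)) e w \<and> entry S (psnd (psnd c)) e w' \<and>
          eval_trm c e = (if w = 0 \<or> w' = 0 then 0 else Suc (uni (w - 1) (w' - 1)))"
          by (rule exI[of _ "eval_trm (pfst (psnd c)) e"], intro conjI,
              use entry_le[OF *(1)] in simp, rule exI[of _ "eval_trm (psnd (psnd c)) e"])
             (use * 4 entry_le[OF *(2)] in \<open>simp add: eval_trm.simps[of c]\<close>)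
        with 4 show ?thesis by blast
      qed (simp_all add: eval_trm.simps[of c])
    qed
    ultimately show ?thesis by (intro exI[of _ ?D]) auto
  qed
qed

lemmas computable_eval_trm' = computable_comp2[OF computable_eval_trm]

lemma eval_trm_trm_code:
  "(eval_trm (trm_code t) e \<noteq> 0 \<longleftrightarrow> fv_trm t \<subseteq> env_dom e) \<and>
   (fv_trm t \<subseteq> env_dom e \<longrightarrow> d (eval_trm (trm_code t) e - 1) = val M (env d e) t)"
  by (induction t) (auto simp: eval_trm.simps[of "prod_encode _"] env_dom_def env_def d_emp d_sing d_uni)

lemma eval_trm_not_code: "c \<notin> range trm_code \<Longrightarrow> eval_trm c e = 0"
proof (induction c rule: less_induct)
  case (less c)
  consider "pfst c = 0" | "pfst c = 1" | "pfst c = 2" | "pfst c = 3" | "pfst c > 3" by linarith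
  then show ?case
  proof cases
    case 1
    then have "c = trm_code (Var (psnd c))" using prod_encode_pfst_psnd[of c] by simp
    with less.prems show ?thesis by blast
  next
    case 2
    then have "c = trm_code \<^bold>\<emptyset>" if "psnd c = 0" using prod_encode_pfst_psnd[of c] that by simp
    with less.prems have "psnd c \<noteq> 0" by (metis rangeI)
    with 2 show ?thesis by (simp add: eval_trm.simps[of c])
  next
    case 3
    then have "c = trm_code \<langle>t\<rangle>" if "psnd c = trm_code t" for t
      using prod_encode_pfst_psnd[of c] that by simp
    with less.prems have "psnd c \<notin> range trm_code" by blast
    with less.IH[of "psnd c"] psnd_less[of c] 3 show ?thesis by (simp add: eval_trm.simps[of c])
  next
    case 4
    then have "c = trm_code (s \<uplus> t)" if "pfst (psnd c) = trm_code s" "psnd (psnd c) = trm_code t" for s t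
      using prod_encode_pfst_psnd[of c] prod_encode_pfst_psnd[of "psnd c"] that by simp
    with less.prems have "pfst (psnd c) \<notin> range trm_code \<or> psnd (psnd c) \<notin> range trm_code" by blast
    with less.IH[of "pfst (psnd c)"] less.IH[of "psnd (psnd c)"] 4
      pfst_psnd_less[of c] psnd_psnd_less[of c]
    show ?thesis by (auto simp: eval_trm.simps[of c])
  qed (simp add: eval_trm.simps[of c])
qed

text \<open>Value \<open>2\<close> signals an error, so that closed formulas are exactly the numbers on which
  evaluation in the empty environment does not fail.\<close>

function eval_fm :: "nat \<Rightarrow> nat \<Rightarrow> nat" where
  "eval_fm c e =
    (if pfst c \<le> 1 then
       (if eval_trm (pfst (psnd c)) e = 0 \<or> eval_trm (psnd (psnd c)) e = 0 then 2
        else if pfst c = 0 then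
          (if eqp (eval_trm (pfst (psnd c)) e - 1) (eval_trm (psnd (psnd c)) e - 1) then 1 else 0)
        else
          (if subp (eval_trm (pfst (psnd c)) e - 1) (eval_trm (psnd (psnd c)) e - 1) then 1 else 0))
     else if pfst c = 2 then
       (if eval_fm (psnd c) e = 2 then 2 else 1 - eval_fm (psnd c) e)
     else if pfst c = 3 then
       (if eval_fm (pfst (psnd c)) e = 2 \<or> eval_fm (psnd (psnd c)) e = 2 then 2
        else if eval_fm (pfst (psnd c)) e = 1 \<and> eval_fm (psnd (psnd c)) e = 0 then 0 else 1)
     else if pfst c = 4 then
       (if \<exists>k\<in>{..G c e}. eval_fm (psnd (psnd c)) (update e (pfst (psnd c)) k) = 2 then 2
        else if \<exists>k\<in>{..G c e}. eval_fm (psnd (psnd c)) (update e (pfst (psnd c)) k) = 0 then 0 else 1)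
     else 2)"
  by auto
termination
  by (relation "measure fst") (auto intro: psnd_less pfst_psnd_less psnd_psnd_less)

declare eval_fm.simps [simp del]

lemma computable_eval_fm: "computable (\<lambda>\<rho>. eval_fm (\<rho> 0) (\<rho> 1))"
proof (rule computable_by_table)
  let ?A = "\<lambda>c e. if eval_trm (pfst (psnd c)) e = 0 \<or> eval_trm (psnd (psnd c)) e = 0 then 2
        else if pfst c = 0 then
          (if eqp (eval_trm (pfst (psnd c)) e - 1) (eval_trm (psnd (psnd c)) e - 1) then 1 else 0)
        else
          (if subp (eval_trm (pfst (psnd c)) e - 1) (eval_trm (psnd (psnd c)) e - 1) then 1 else 0)"
  let ?E = "\<lambda>S c e k w. entry S (psnd (psnd c)) (update e (pfst (psnd c)) k) w"
  \<comment> \<open>In the quantifier clause the table must list a value for every instance: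
    otherwise a missing instance could not be told from a true one.\<close>
  let ?C = "\<lambda>S c e v. (pfst c \<le> 1 \<and> v = ?A c e) \<or>
    (pfst c = 2 \<and> (\<exists>w\<le>S. entry S (psnd c) e w \<and> v = (if w = 2 then 2 else 1 - w))) \<or>
    (pfst c = 3 \<and> (\<exists>w\<le>S. \<exists>w'\<le>S. entry S (pfst (psnd c)) e w \<and> entry S (psnd (psnd c)) e w' \<and>
      v = (if w = 2 \<or> w' = 2 then 2 else if w = 1 \<and> w' = 0 then 0 else 1))) \<or>
    (pfst c = 4 \<and> (\<forall>k\<le>G c e. \<exists>w\<le>S. ?E S c e k w) \<and>
      v = (if \<exists>k\<le>G c e. ?E S c e k 2 then 2 else if \<exists>k\<le>G c e. ?E S c e k 0 then 0 else 1)) \<or>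
    (4 < pfst c \<and> v = 2)"
  show "decidable (\<lambda>\<rho>. ?C (\<rho> 0) (\<rho> 1) (\<rho> 2) (\<rho> 3))"
    by (intro computable_intros computable_ops computable_eval_trm')
  show "v = eval_fm c e" if entry: "\<And>c' e' v'. entry S c' e' v' \<Longrightarrow> c' < c \<Longrightarrow> v' = eval_fm c' e'"
    and C: "?C S c e v" for S c e v
  proof -
    have less: "psnd c < c" "pfst (psnd c) < c" "psnd (psnd c) < c" if "pfst c \<noteq> 0"
      using that psnd_less pfst_psnd_less psnd_psnd_less by simp_all
    consider "pfst c \<le> 1" | "pfst c = 2" | "pfst c = 3" | "pfst c = 4" | "pfst c > 4" by linarith
    then show ?thesis
    proof cases
      case 1
      with C have "v = ?A c e" by simp
      with 1 show ?thesis by (simp add: eval_fm.simps[of c])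
    next
      case 2
      with C obtain w where "entry S (psnd c) e w" "v = (if w = 2 then 2 else 1 - w)" by auto
      with entry[OF this(1)] less 2 show ?thesis by (simp add: eval_fm.simps[of c])
    next
      case 3
      with C obtain w w' where "entry S (pfst (psnd c)) e w" "entry S (psnd (psnd c)) e w'"
        "v = (if w = 2 \<or> w' = 2 then 2 else if w = 1 \<and> w' = 0 then 0 else 1)" by auto
      with entry[OF this(1)] entry[OF this(2)] less 3 show ?thesis by (simp add: eval_fm.simps[of c])
    next
      case 4
      with C have all: "\<forall>k\<le>G c e. \<exists>w\<le>S. ?E S c e k w"
        and v: "v = (if \<exists>k\<le>G c e. ?E S c e k 2 then 2 else if \<exists>k\<le>G c e. ?E S c e k 0 then 0 else 1)"
        by simp_all
      have "?E S c e k w \<longleftrightarrow> eval_fm (psnd (psnd c)) (update e (pfst (psnd c)) k) = w"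
        if "k \<le> G c e" for k w
        using all that entry less 4 by fastforce
      then have "(\<exists>k\<le>G c e. ?E S c e k w) \<longleftrightarrow>
          (\<exists>k\<in>{..G c e}. eval_fm (psnd (psnd c)) (update e (pfst (psnd c)) k) = w)" for w
        by auto
      with v 4 show ?thesis by (simp add: eval_fm.simps[of c])
    next
      case 5
      with C show ?thesis by (simp add: eval_fm.simps[of c])
    qed
  qed
  show "\<exists>D. finite D \<and> (\<forall>(c', e')\<in>D. c' < c) \<and>
      (\<forall>S. (\<forall>(c', e')\<in>D. entry S c' e' (eval_fm c' e')) \<longrightarrow>
        (\<forall>c' e' v'. entry S c' e' v' \<longrightarrow> v' = eval_fm c' e') \<longrightarrow> ?C S c e (eval_fm c e))" for c e
  proof -
    let ?D = "if pfst c = 0 then {} else {(psnd c, e), (pfst (psnd c), e), (psnd (psnd c), e)} \<union>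
      (\<lambda>k. (psnd (psnd c), update e (pfst (psnd c)) k)) ` {..G c e}"
    have "\<forall>(c', e')\<in>?D. c' < c"
      using psnd_less[of c] pfst_psnd_less[of c] psnd_psnd_less[of c] by auto
    moreover have "?C S c e (eval_fm c e)"
      if D: "\<forall>(c', e')\<in>?D. entry S c' e' (eval_fm c' e')"
        and correct: "\<forall>c' e' v'. entry S c' e' v' \<longrightarrow> v' = eval_fm c' e'" for S
    proof -
      consider "pfst c \<le> 1" | "pfst c = 2" | "pfst c = 3" | "pfst c = 4" | "pfst c > 4" by linarith
      then show ?thesis
      proof cases
        case 2
        with D have "entry S (psnd c) e (eval_fm (psnd c) e)" by simp
        with 2 entry_le[OF this] show ?thesis by (auto simp: eval_fm.simps[of c])
      next
        case 3
        with D have *: "entry S (pfst (psnd c)) e (eval_fm (pfst (psnd c)) e)"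
          "entry S (psnd (psnd c)) e (eval_fm (psnd (psnd c)) e)" by simp_all
        have "\<exists>w\<le>S. \<exists>w'\<le>S. entry S (pfst (psnd c)) e w \<and> entry S (psnd (psnd c)) e w' \<and>
          eval_fm c e = (if w = 2 \<or> w' = 2 then 2 else if w = 1 \<and> w' = 0 then 0 else 1)"
          by (rule exI[of _ "eval_fm (pfst (psnd c)) e"], intro conjI,
              use entry_le[OF *(1)] in simp, rule exI[of _ "eval_fm (psnd (psnd c)) e"])
             (use * 3 entry_le[OF *(2)] in \<open>simp add: eval_fm.simps[of c]\<close>)
        with 3 show ?thesis by blast
      next
        case 4
        with D have *: "?E S c e k (eval_fm (psnd (psnd c)) (update e (pfst (psnd c)) k))"
          if "k \<le> G c e" for k
          using that by auto
        then have all: "\<forall>k\<le>G c e. \<exists>w\<le>S. ?E S c e k w" using entry_le by blast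
        have "?E S c e k w \<longleftrightarrow> eval_fm (psnd (psnd c)) (update e (pfst (psnd c)) k) = w"
          if "k \<le> G c e" for k w
          using *[OF that] correct by blast
        then have "(\<exists>k\<le>G c e. ?E S c e k w) \<longleftrightarrow>
            (\<exists>k\<in>{..G c e}. eval_fm (psnd (psnd c)) (update e (pfst (psnd c)) k) = w)" for w
          by auto
        with 4 all show ?thesis by (simp add: eval_fm.simps[of c])
      qed (simp_all add: eval_fm.simps[of c])
    qed
    ultimately show ?thesis by (intro exI[of _ ?D]) auto
  qed
qed

lemma eval_fm_fm_code:
  "eval_fm (fm_code \<phi>) e = (if fv \<phi> \<subseteq> env_dom e then if sat M (env d e) \<phi> then 1 else 0 else 2)"
proof (induction \<phi> arbitrary: e)
  case (Eq s t)
  show ?case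
  proof (cases "fv_trm s \<subseteq> env_dom e \<and> fv_trm t \<subseteq> env_dom e")
    case True
    then show ?thesis
      using eval_trm_trm_code[of s e] eval_trm_trm_code[of t e]
        eqp[of "eval_trm (trm_code s) e - 1" "eval_trm (trm_code t) e - 1"]
      by (simp add: eval_fm.simps[of "prod_encode _"] del: neq0_conv)
  next
    case False
    then have "eval_trm (trm_code s) e = 0 \<or> eval_trm (trm_code t) e = 0"
      using eval_trm_trm_code by blast
    with False show ?thesis by (auto simp: eval_fm.simps[of "prod_encode _"])
  qed
next
  case (Sub s t)
  show ?case
  proof (cases "fv_trm s \<subseteq> env_dom e \<and> fv_trm t \<subseteq> env_dom e")
    case True
    then show ?thesis
      using eval_trm_trm_code[of s e] eval_trm_trm_code[of t e]
        subp[of "eval_trm (trm_code s) e - 1" "eval_trm (trm_code t) e - 1"]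
      by (simp add: eval_fm.simps[of "prod_encode _"] del: neq0_conv)
  next
    case False
    then have "eval_trm (trm_code s) e = 0 \<or> eval_trm (trm_code t) e = 0"
      using eval_trm_trm_code by blast
    with False show ?thesis by (auto simp: eval_fm.simps[of "prod_encode _"])
  qed
next
  case (Neg \<phi>)
  then show ?case by (simp add: eval_fm.simps[of "prod_encode _"])
next
  case (Imp \<phi> \<psi>)
  then show ?case by (simp add: eval_fm.simps[of "prod_encode _"])
next
  case (All x \<phi>)
  let ?G = "G (fm_code (\<^bold>\<forall>x. \<phi>)) e"
  have dom: "fv \<phi> - {x} \<subseteq> env_dom e \<longleftrightarrow> fv \<phi> \<subseteq> insert x (env_dom e)" by auto
  \<comment> \<open>Here the quantifier over the structure becomes one over an initial segment of
    the naturals.\<close>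
  have "(\<forall>a. sat M ((env d e)(x := a)) \<phi>) \<longleftrightarrow> (\<forall>k\<le>?G. sat M ((env d e)(x := d k)) \<phi>)"
    using bounded_witness by metis
  then show ?case
    by (auto simp: eval_fm.simps[of "prod_encode _"] All env_update env_dom_update dom)
qed

text \<open>The decision procedure receives arbitrary numbers, so those that code no formula must be
  rejected as well.\<close>

lemma eval_fm_not_code: "c \<notin> range fm_code \<Longrightarrow> eval_fm c e = 2"
proof (induction c arbitrary: e rule: less_induct)
  case (less c)
  have c: "c = prod_encode (pfst c, prod_encode (pfst (psnd c), psnd (psnd c)))" by simp
  consider "pfst c = 0" | "pfst c = 1" | "pfst c = 2" | "pfst c = 3" | "pfst c = 4" | "pfst c > 4"
    by linarith
  then show ?case
  proof cases
    case 1
    then have "c = fm_code (s \<doteq> t)" if "pfst (psnd c) = trm_code s" "psnd (psnd c) = trm_code t" for s t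
      using that c by simp
    with less.prems have "pfst (psnd c) \<notin> range trm_code \<or> psnd (psnd c) \<notin> range trm_code" by blast
    with 1 show ?thesis by (auto simp: eval_fm.simps[of c] eval_trm_not_code)
  next
    case 2
    then have "c = fm_code (s \<sqsubseteq> t)" if "pfst (psnd c) = trm_code s" "psnd (psnd c) = trm_code t" for s t
      using that c by simp
    with less.prems have "pfst (psnd c) \<notin> range trm_code \<or> psnd (psnd c) \<notin> range trm_code" by blast
    with 2 show ?thesis by (auto simp: eval_fm.simps[of c] eval_trm_not_code)
  next
    case 3
    then have "c = fm_code (\<^bold>\<not> \<phi>)" if "psnd c = fm_code \<phi>" for \<phi>
      using prod_encode_pfst_psnd[of c] that by simp
    with less.prems have "psnd c \<notin> range fm_code" by blast
    with less.IH[of "psnd c"] psnd_less[of c] 3 show ?thesis by (simp add: eval_fm.simps[of c])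
  next
    case 4
    then have "c = fm_code (\<phi> \<^bold>\<longrightarrow> \<psi>)" if "pfst (psnd c) = fm_code \<phi>" "psnd (psnd c) = fm_code \<psi>" for \<phi> \<psi>
      using that c by simp
    with less.prems have "pfst (psnd c) \<notin> range fm_code \<or> psnd (psnd c) \<notin> range fm_code" by blast
    with less.IH[of "pfst (psnd c)"] less.IH[of "psnd (psnd c)"] 4
      pfst_psnd_less[of c] psnd_psnd_less[of c]
    show ?thesis by (auto simp: eval_fm.simps[of c])
  next
    case 5
    then have "c = fm_code (\<^bold>\<forall>pfst (psnd c). \<phi>)" if "psnd (psnd c) = fm_code \<phi>" for \<phi>
      using that c by simp
    with less.prems have "psnd (psnd c) \<notin> range fm_code" by blast
    \<comment> \<open>The range \<open>{..G c e}\<close> contains 0, so the faulty body is evaluated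
      at least once and its error is seen.\<close>
    with less.IH[of "psnd (psnd c)"] psnd_psnd_less[of c] 5
    show ?thesis by (auto simp: eval_fm.simps[of c])
  qed (simp add: eval_fm.simps[of c])
qed

theorem recursive_set_Th: "recursive_set (fm_code ` Th M)"
proof (rule recursive_set_decidable)
  have code: "eval_fm (fm_code \<phi>) 0 = 1 \<longleftrightarrow> \<phi> \<in> Th M" for \<phi>
    using sentence_sat[of \<phi> M "env d 0"]
    by (auto simp: eval_fm_fm_code Th_def sentence_def env_dom_def)
  have "c \<in> fm_code ` Th M \<longleftrightarrow> eval_fm c 0 = 1" for c
  proof
    assume "c \<in> fm_code ` Th M"
    then show "eval_fm c 0 = 1" using code by blast
  next
    assume 1: "eval_fm c 0 = 1"
    then have "c \<in> range fm_code" using eval_fm_not_code[of c 0] by fastforce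
    then show "c \<in> fm_code ` Th M" using code 1 by blast
  qed
  then show "decidable (\<lambda>\<rho>. \<rho> 0 \<in> fm_code ` Th M)"
    by (simp only:) (intro computable_intros computable_comp2[OF computable_eval_fm])
qed

end

section \<open>A back-and-forth system for integer linear forms\<close>

definition lin :: "nat \<Rightarrow> (nat \<Rightarrow> int) \<Rightarrow> int \<Rightarrow> (nat \<Rightarrow> int) \<Rightarrow> int" where
  "lin n f c e = (\<Sum>i<n. f i * e i) + c"

definition small :: "int \<Rightarrow> (nat \<Rightarrow> int) \<Rightarrow> int \<Rightarrow> bool" where
  "small L f c \<longleftrightarrow> (\<forall>i. \<bar>f i\<bar> \<le> L) \<and> \<bar>c\<bar> \<le> L"

text \<open>The invariant of the back-and-forth game.\<close>

definition similar :: "nat \<Rightarrow> nat \<Rightarrow> (nat \<Rightarrow> int) \<Rightarrow> (nat \<Rightarrow> int) \<Rightarrow> bool" where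
  "similar n L e e' \<longleftrightarrow>
    (\<forall>f c. small (int L) f c \<longrightarrow> (0 \<le> lin n f c e \<longleftrightarrow> 0 \<le> lin n f c e')) \<and>
    (\<forall>i<n. fact L dvd e i - e' i)"

lemma lin_add: "lin n f c e + lin n g b e = lin n (\<lambda>i. f i + g i) (c + b) e"
  by (simp add: lin_def sum.distrib distrib_right)

lemma lin_diff: "lin n f c e - lin n g b e = lin n (\<lambda>i. f i - g i) (c - b) e"
  by (simp add: lin_def sum_subtractf left_diff_distrib)

lemma lin_mult: "k * lin n f c e = lin n (\<lambda>i. k * f i) (k * c) e"
  by (simp add: lin_def distrib_left sum_distrib_left mult.assoc)

lemma lin_add_const: "lin n f c e + k = lin n f (c + k) e"
  by (simp add: lin_def)

lemma small_add: "small K f c \<Longrightarrow> small L g b \<Longrightarrow> small (K + L) (\<lambda>i. f i + g i) (c + b)"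
  unfolding small_def by (meson abs_triangle_ineq add_mono order_trans)

lemma small_diff: "small K f c \<Longrightarrow> small L g b \<Longrightarrow> small (K + L) (\<lambda>i. f i - g i) (c - b)"
  unfolding small_def by (meson abs_triangle_ineq4 add_mono order_trans)

lemma small_mult: "small L f c \<Longrightarrow> \<bar>k\<bar> \<le> K \<Longrightarrow> small (K * L) (\<lambda>i. k * f i) (k * c)"
  unfolding small_def abs_mult by (meson abs_ge_zero mult_mono order_trans)

lemma small_add_const: "small L f c \<Longrightarrow> \<bar>k\<bar> \<le> K \<Longrightarrow> small (L + K) f (c + k)"
  unfolding small_def using abs_triangle_ineq[of c k] by (metis abs_ge_zero add_increasing2 add_mono order_trans)

lemma small_mono: "small K f c \<Longrightarrow> K \<le> L \<Longrightarrow> small L f c"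
  unfolding small_def by (meson order_trans)

lemma lin_update: "x < n \<Longrightarrow> lin n f c (e(x := a)) = f x * a + lin n (f(x := 0)) c e"
proof -
  assume x: "x < n"
  have "(\<Sum>i<n. f i * (e(x := a)) i) = f x * a + (\<Sum>i\<in>{..<n} - {x}. f i * e i)"
    using x by (subst sum.remove[of _ x]) auto
  moreover have "(\<Sum>i<n. (f(x := 0)) i * e i) = (\<Sum>i\<in>{..<n} - {x}. f i * e i)"
    using x by (subst sum.remove[of _ x]) auto
  ultimately show ?thesis by (simp add: lin_def)
qed

lemma similar_refl: "similar n L e e"
  by (simp add: similar_def)

lemma similar_mono: "similar n L e e' \<Longrightarrow> K \<le> L \<Longrightarrow> similar n K e e'"
  unfolding similar_def by (meson fact_dvd dvd_trans of_nat_mono small_mono)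

lemma similar_lin: "similar n L e e' \<Longrightarrow> small (int L) f c \<Longrightarrow> 0 \<le> lin n f c e \<longleftrightarrow> 0 \<le> lin n f c e'"
  unfolding similar_def by blast

lemma similar_dvd: "similar n L e e' \<Longrightarrow> fact L dvd lin n f c e - lin n f c e'"
proof -
  assume "similar n L e e'"
  then have "fact L dvd (\<Sum>i<n. f i * (e i - e' i))"
    unfolding similar_def by (intro dvd_sum) auto
  then show ?thesis by (simp add: lin_def right_diff_distrib sum_subtractf)
qed

lemma lin_bound:
  assumes "small K f c" "\<And>i. i < n \<Longrightarrow> \<bar>e i\<bar> \<le> N"
  shows "\<bar>lin n f c e\<bar> \<le> K * (int n * N + 1)"
proof -
  have "\<bar>f i * e i\<bar> \<le> K * N" if "i < n" for i
    using assms that unfolding small_def abs_mult by (meson abs_ge_zero mult_mono order_trans)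
  then have "\<bar>\<Sum>i<n. f i * e i\<bar> \<le> (\<Sum>i<n. K * N)"
    by (intro order_trans[OF sum_abs] sum_mono) auto
  then have "\<bar>\<Sum>i<n. f i * e i\<bar> \<le> int n * (K * N)" by simp
  moreover have "\<bar>c\<bar> \<le> K" using assms(1) by (simp add: small_def)
  ultimately have "\<bar>lin n f c e\<bar> \<le> int n * (K * N) + K" unfolding lin_def by linarith
  then show ?thesis by (simp add: algebra_simps)
qed

text \<open>The representative of \<open>\<bar>\<delta>\<bar>\<close> modulo \<open>W\<close> is
  taken in 1..W rather than 0..W-1, so that a large displacement never becomes 0 and keeps its
  sign.\<close>

lemma truncate_displacement:
  fixes \<delta> W :: int
  assumes W: "0 < W"
  obtains \<delta>' where "\<bar>\<delta>'\<bar> \<le> W" "W dvd \<delta>' - \<delta>" "\<bar>\<delta>\<bar> \<le> W \<Longrightarrow> \<delta>' = \<delta>"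
    "W < \<delta> \<Longrightarrow> 0 < \<delta>'" "\<delta> < - W \<Longrightarrow> \<delta>' < 0"
proof -
  define m where "m = (\<bar>\<delta>\<bar> - 1) mod W + 1"
  have m: "0 < m" "m \<le> W"
    using pos_mod_bound[OF W, of "\<bar>\<delta>\<bar> - 1"] pos_mod_sign[OF W, of "\<bar>\<delta>\<bar> - 1"] by (simp_all add: m_def)
  have dvd: "W dvd m - \<bar>\<delta>\<bar>"
    by (simp add: m_def) (metis (no_types, opaque_lifting) add_diff_cancel_right' diff_diff_eq2 dvd_minus_mod dvd_minus_iff minus_diff_eq diff_add_cancel)
  consider "\<bar>\<delta>\<bar> \<le> W" | "W < \<delta>" | "\<delta> < - W" by linarith
  then show thesis
  proof cases
    case 1
    then show ?thesis using that[of \<delta>] W by auto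
  next
    case 2
    then show ?thesis using that[of m] m dvd by auto
  next
    case 3
    have "- m - \<delta> = - (m - \<bar>\<delta>\<bar>)" using 3 W by simp
    then have "W dvd - m - \<delta>" using dvd by (metis dvd_minus_iff)
    then show ?thesis using that[of "- m"] m 3 by auto
  qed
qed

text \<open>Scale all comparisons of the new value \<open>a\<close> with forms in the old ones so that \<open>a\<close> gets the
  coefficient \<open>fact L\<close>. The answer \<open>a'\<close> has the same displacement from the form nearest to
  \<open>fact L * a\<close>, except that a large displacement is reduced, preserving its sign and residue.\<close>

lemma similar_extend:
  assumes sim: "similar n (4 * (fact L)\<^sup>2) e e'" and x: "x < n"
    and N: "\<And>i. i < n \<Longrightarrow> \<bar>e' i\<bar> \<le> N"
  obtains a' where "similar n L (e(x := a)) (e'(x := a'))"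
    and "\<bar>a'\<bar> \<le> 4 * (fact L)\<^sup>2 * (int n * N + 1)"
proof -
  \<comment> \<open>\<open>D\<close> is the common coefficient of the new value. Forms of size
    \<open>L\<close>, scaled by at most \<open>D\<close>, have size \<open>K\<close>, and
    \<open>K\<close> is at most \<open>W\<close> because \<open>L\<close> is at most
    \<open>D\<close>. Differences of two such forms, shifted by up to \<open>2 * W\<close>, have
    size \<open>4 * W\<close>: this is the precision demanded.\<close>
  define D :: int where "D = fact L"
  define K where "K = D * int L"
  define W where "W = D * D"
  define L' :: nat where "L' = 4 * (fact L)\<^sup>2"
  have D: "1 \<le> D" by (simp add: D_def fact_ge_1)
  have LD: "int L \<le> D" unfolding D_def using fact_ge_self[of L] by (metis of_nat_fact of_nat_mono)
  have DW: "D \<le> W" using mult_left_mono[of 1 D D] D by (simp add: W_def)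
  have KW: "0 \<le> K" "K \<le> W" using D LD by (auto simp: K_def W_def mult_left_mono)
  have W: "0 < W" using D by (simp add: W_def)
  have L': "int L' = 4 * W" by (simp add: L'_def W_def D_def power2_eq_square)
  have sign: "0 \<le> lin n f c e \<longleftrightarrow> 0 \<le> lin n f c e'" if "small (4 * W) f c" for f c
    using similar_lin[OF sim] that L' unfolding L'_def by simp
  have N0: "0 \<le> N" using N[OF x] by linarith
  \<comment> \<open>The forms must avoid \<open>x\<close>, whose old value is overwritten.
    \<open>P\<close> is infinite or large, but distances to \<open>D * a\<close> are naturals, so a
    nearest form exists.\<close>
  define P where "P = {(f, c). small K f c \<and> f x = 0}"
  have "(\<lambda>_. 0, 0) \<in> P" using KW by (simp add: P_def small_def)
  then obtain p where "p \<in> P" and p: "\<forall>q. q \<in> P \<longrightarrow>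
      nat \<bar>D * a - (\<lambda>(f, c). lin n f c e) p\<bar> \<le> nat \<bar>D * a - (\<lambda>(f, c). lin n f c e) q\<bar>"
    using ex_has_least_nat[of "\<lambda>p. p \<in> P" _ "\<lambda>p. nat \<bar>D * a - (\<lambda>(f, c). lin n f c e) p\<bar>"] by blast
  moreover obtain f0 c0 where "p = (f0, c0)" by (cases p)
  ultimately have f0: "small K f0 c0" "f0 x = 0"
    and near: "\<And>g b. small K g b \<Longrightarrow> g x = 0 \<Longrightarrow> \<bar>D * a - lin n f0 c0 e\<bar> \<le> \<bar>D * a - lin n g b e\<bar>"
    by (auto simp: P_def split_beta nat_le_eq_zle)
  define \<delta> where "\<delta> = D * a - lin n f0 c0 e"
  obtain \<delta>' where \<delta>': "\<bar>\<delta>'\<bar> \<le> W" "W dvd \<delta>' - \<delta>" "\<bar>\<delta>\<bar> \<le> W \<Longrightarrow> \<delta>' = \<delta>"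
    "W < \<delta> \<Longrightarrow> 0 < \<delta>'" "\<delta> < - W \<Longrightarrow> \<delta>' < 0"
    using truncate_displacement[OF W] by metis
  have "W dvd fact L'"
  proof -
    have "(fact L)\<^sup>2 dvd (fact L' :: nat)" by (rule dvd_fact) (auto simp: L'_def)
    then have "int ((fact L)\<^sup>2) dvd int (fact L')" by (rule of_nat_dvd_iff[THEN iffD2])
    then show ?thesis by (simp add: W_def D_def power2_eq_square)
  qed
  then have "W dvd lin n f0 c0 e - lin n f0 c0 e'"
    using similar_dvd[OF sim] unfolding L'_def by (meson dvd_trans)
  with \<delta>'(2) have "W dvd (\<delta>' - \<delta>) - (lin n f0 c0 e - lin n f0 c0 e')" by (rule dvd_diff)
  \<comment> \<open>The target \<open>lin n f0 c0 e' + \<delta>'\<close> is congruent to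
    \<open>D * a\<close> modulo \<open>D * D\<close>. Hence it is divisible by \<open>D\<close>, and
    the quotient is congruent to \<open>a\<close> modulo \<open>D\<close>, as the residue part of
    the invariant demands.\<close>
  then obtain q where "(\<delta>' - \<delta>) - (lin n f0 c0 e - lin n f0 c0 e') = W * q" by (elim dvdE)
  then have Da': "D * (a + D * q) = lin n f0 c0 e' + \<delta>'"
    unfolding \<delta>_def W_def by (simp add: algebra_simps)
  define a' where "a' = a + D * q"
  note Da' = Da'[folded a'_def]
  have cmp: "(0 \<le> D * a - lin n g b e \<longleftrightarrow> 0 \<le> D * a' - lin n g b e') \<and>
      (0 \<le> lin n g b e - D * a \<longleftrightarrow> 0 \<le> lin n g b e' - D * a')"
    if g: "small K g b" "g x = 0" for g b
  proof -
    have s: "small (2 * W) (\<lambda>i. f0 i - g i) (c0 - b)" "small (2 * W) (\<lambda>i. g i - f0 i) (b - c0)"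
      using small_diff[OF f0(1) g(1)] small_diff[OF g(1) f0(1)] KW by (auto elim: small_mono)
    have shift: "0 \<le> lin n f0 c0 e - lin n g b e + k \<longleftrightarrow> 0 \<le> lin n f0 c0 e' - lin n g b e' + k"
      "0 \<le> lin n g b e - lin n f0 c0 e + k \<longleftrightarrow> 0 \<le> lin n g b e' - lin n f0 c0 e' + k"
      if "\<bar>k\<bar> \<le> 2 * W" for k
      using small_add_const[OF s(1) that] small_add_const[OF s(2) that]
      unfolding lin_diff lin_add_const by (auto intro!: sign)
    define u where "u = lin n f0 c0 e - lin n g b e"
    define u' where "u' = lin n f0 c0 e' - lin n g b e'"
    have eq: "D * a - lin n g b e = u + \<delta>" "lin n g b e - D * a = - u + - \<delta>"
      "D * a' - lin n g b e' = u' + \<delta>'" "lin n g b e' - D * a' = - u' + - \<delta>'"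
      using Da' by (simp_all add: u_def u'_def \<delta>_def)
    have u: "0 \<le> u + k \<longleftrightarrow> 0 \<le> u' + k" "0 \<le> - u + k \<longleftrightarrow> 0 \<le> - u' + k" if "\<bar>k\<bar> \<le> 2 * W" for k
      using shift[OF that] by (simp_all add: u_def u'_def)
    have near': "\<bar>\<delta>\<bar> \<le> \<bar>u + \<delta>\<bar>" using near[OF g] unfolding eq(1) \<delta>_def .
    consider "\<bar>\<delta>\<bar> \<le> W" | "W < \<delta>" | "\<delta> < - W" by linarith
    then show ?thesis
    proof cases
      case 1
      then have "\<bar>\<delta>\<bar> \<le> 2 * W" "\<bar>- \<delta>\<bar> \<le> 2 * W" using W by linarith+
      then show ?thesis unfolding eq \<delta>'(3)[OF 1] using u(1) u(2) by blast
    next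
      case 2
      \<comment> \<open>Minimality leaves a gap: a form is either at most the nearest one or exceeds
        it by more than \<open>2 * W\<close>. Since \<open>0 < \<delta>' \<le> W\<close>, the value
        \<open>D * a'\<close> lies in the corresponding gap on the other side. The next case is its
        mirror image.\<close>
      have "0 \<le> u + 0 \<or> u + \<delta> < 0 \<and> 0 \<le> - u + - 2 * W" using near' 2 W by linarith
      then have "0 \<le> u + 0 \<and> 0 \<le> u' + 0 \<or> u + \<delta> < 0 \<and> 0 \<le> - u + - 2 * W \<and> 0 \<le> - u' + - 2 * W"
        using u(1)[of 0] u(2)[of "- 2 * W"] W by simp
      then show ?thesis unfolding eq using 2 \<delta>'(1) \<delta>'(4)[OF 2] W by (elim disjE conjE) (intro conjI; linarith)+
    next
      case 3
      have "0 \<le> - u + 0 \<or> 0 < u + \<delta> \<and> 0 \<le> u + - 2 * W" using near' 3 W by linarith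
      then have "0 \<le> - u + 0 \<and> 0 \<le> - u' + 0 \<or> 0 < u + \<delta> \<and> 0 \<le> u + - 2 * W \<and> 0 \<le> u' + - 2 * W"
        using u(2)[of 0] u(1)[of "- 2 * W"] W by simp
      then show ?thesis unfolding eq using 3 \<delta>'(1) \<delta>'(5)[OF 3] W by (elim disjE conjE) (intro conjI; linarith)+
    qed
  qed
  have "similar n L (e(x := a)) (e'(x := a'))"
    unfolding similar_def
  proof (intro conjI allI impI)
    fix i assume "i < n"
    then have "fact L' dvd e i - e' i" using sim unfolding similar_def L'_def by blast
    moreover have "fact L dvd (fact L' :: int)"
    proof (rule fact_dvd)
      have "L \<le> fact L" by (rule fact_ge_self)
      also have "(fact L :: nat) \<le> L'" unfolding L'_def by (simp add: power2_eq_square)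
      finally show "L \<le> L'" .
    qed
    ultimately show "fact L dvd (e(x := a)) i - (e'(x := a')) i"
      by (auto simp: a'_def D_def intro: dvd_trans)
  next
    fix f c assume f: "small (int L) f c"
    let ?l = "lin n (f(x := 0)) c"
    have l: "small (int L) (f(x := 0)) c" using f by (simp add: small_def)
    have scaled: "small K (\<lambda>i. k * (f(x := 0)) i) (k * c)" if "\<bar>k\<bar> \<le> D" for k
      using small_mult[OF l that] by (simp add: K_def)
    have "0 \<le> f x * a + ?l e \<longleftrightarrow> 0 \<le> f x * a' + ?l e'"
    proof (cases "f x = 0")
      case True
      have "small (4 * W) (f(x := 0)) c"
        using small_mono[OF l] LD DW W by simp
      then show ?thesis using True sign by simp
    next
      case False
      \<comment> \<open>Multiplying by the cofactor \<open>k\<close> of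
        \<open>\<bar>f x\<bar>\<close> in \<open>D\<close> turns the coefficient of the new value
        into \<open>D\<close> or \<open>- D\<close>; the sign decides which half of
        \<open>cmp\<close> applies.\<close>
      have "\<bar>f x\<bar> \<le> int L" using f by (simp add: small_def)
      then have "nat \<bar>f x\<bar> dvd fact L" using False by (intro dvd_fact) auto
      then have "int (nat \<bar>f x\<bar>) dvd int (fact L)" by (rule of_nat_dvd_iff[THEN iffD2])
      then have "\<bar>f x\<bar> dvd D" by (simp add: D_def)
      then obtain k where k: "D = \<bar>f x\<bar> * k" by (elim dvdE)
      moreover from k have "0 < \<bar>f x\<bar> * k" using D by simp
      ultimately have k0: "0 < k" using False by (simp add: zero_less_mult_iff)
      have "1 * k \<le> \<bar>f x\<bar> * k" using False k0 by (intro mult_right_mono) auto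
      then have kD: "\<bar>k\<bar> \<le> D" "\<bar>- k\<bar> \<le> D" using k k0 by auto
      have scale: "0 \<le> y \<longleftrightarrow> 0 \<le> k * y" for y using k0 by (simp add: zero_le_mult_iff)
      show ?thesis
      proof (cases "0 < f x")
        case True
        then have eq: "k * (f x * a + ?l e) = D * a - (- k) * ?l e"
          "k * (f x * a' + ?l e') = D * a' - (- k) * ?l e'" by (simp_all add: k algebra_simps)
        show ?thesis
          using cmp[OF scaled[OF kD(2)]]
          unfolding scale[of "f x * a + ?l e"] scale[of "f x * a' + ?l e'"] eq lin_mult by simp
      next
        case neg: False
        then have eq: "k * (f x * a + ?l e) = k * ?l e - D * a"
          "k * (f x * a' + ?l e') = k * ?l e' - D * a'" using False by (simp_all add: k algebra_simps)
        show ?thesis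
          using cmp[OF scaled[OF kD(1)]]
          unfolding scale[of "f x * a + ?l e"] scale[of "f x * a' + ?l e'"] eq lin_mult by simp
      qed
    qed
    then show "0 \<le> lin n f c (e(x := a)) \<longleftrightarrow> 0 \<le> lin n f c (e'(x := a'))"
      unfolding lin_update[OF x] .
  qed
  moreover have "\<bar>a'\<bar> \<le> 4 * (fact L)\<^sup>2 * (int n * N + 1)"
  proof -
    have "0 \<le> int n * N" using N0 by simp
    then have X: "0 \<le> int n * N + 1" "1 \<le> int n * N + 1" by linarith+
    have "\<bar>a'\<bar> \<le> \<bar>D * a'\<bar>" using D by (simp add: abs_mult mult_le_cancel_right1)
    also have "\<dots> \<le> K * (int n * N + 1) + W"
      using lin_bound[OF f0(1), of n e' N, OF N] \<delta>'(1) unfolding Da' by linarith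
    also have "\<dots> \<le> W * (int n * N + 1) + W * (int n * N + 1)"
      using mult_right_mono[OF KW(2) X(1)] mult_left_mono[of 1 "int n * N + 1" W] X W by linarith
    also have "\<dots> \<le> 4 * W * (int n * N + 1)"
      using mult_nonneg_nonneg[of W "int n * N + 1"] X W by linarith
    finally show ?thesis by (simp add: W_def D_def power2_eq_square)
  qed
  ultimately show thesis by (rule that)
qed

section \<open>Structures with linear operations\<close>

text \<open>The precision needed to transfer a formula with code \<open>c\<close>; each quantifier costs one application
  of \<open>similar_extend\<close>, and subformulas have smaller codes.\<close>

primrec prec :: "nat \<Rightarrow> nat" where
  "prec 0 = 4"
| "prec (Suc c) = 4 * (fact (prec c))\<^sup>2"

text \<open>This is the precision for atoms: a term of code \<open>a\<close> is a form of size
  \<open>2 ^ a\<close>, and an atom compares two of them.\<close>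

lemma prec_ge: "4 * 2 ^ c \<le> prec c"
proof (induction c)
  case (Suc c)
  have "prec c \<le> fact (prec c)" by (rule fact_ge_self)
  then have "prec c * 1 \<le> fact (prec c) * fact (prec c)" by (intro mult_le_mono) (auto simp: fact_ge_1)
  then show ?case using Suc by (simp add: power2_eq_square)
qed simp

lemma prec_pos: "1 \<le> prec c"
  by (cases c) (simp_all add: Suc_le_eq)

lemma prec_mono: "c \<le> c' \<Longrightarrow> prec c \<le> prec c'"
proof (rule lift_Suc_mono_le[of prec])
  fix c
  have "prec c \<le> fact (prec c)" by (rule fact_ge_self)
  then have "prec c * 1 \<le> fact (prec c) * fact (prec c)" by (intro mult_le_mono) (auto simp: fact_ge_1)
  then show "prec c \<le> prec (Suc c)" by (simp add: power2_eq_square)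
qed

lemma computable_prec [computable_intros]:
  assumes "computable f" shows "computable (\<lambda>\<rho>. prec (f \<rho>))"
proof -
  have *: "prec c = rec_nat 4 (\<lambda>_ y. 4 * (fact y)\<^sup>2) c" for c by (induction c) auto
  have "computable (\<lambda>\<rho>. prec (\<rho> 0))" unfolding * by (intro computable_intros)
  from computable_comp1[OF this assms] show ?thesis .
qed

text \<open>\<open>range\<close> says that membership in the image of \<open>\<iota>\<close> depends
  on the sign alone, as for the naturals and the integers; this lets an integer answer be pulled
  back. \<open>sing\<close> covers x+1, 2x+1 and the constant 1. \<open>sub\<close> says that the
  relation is determined by comparing its arguments with each other and with 1.\<close>

locale lin_struct =
  fixes M :: "'a lstruct" and \<iota> :: "'a \<Rightarrow> int"
  assumes inj: "\<iota> a = \<iota> b \<Longrightarrow> a = b"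
    and range: "(0 \<le> \<iota> a \<longleftrightarrow> 0 \<le> z) \<Longrightarrow> z \<in> range \<iota>"
    and emp: "\<iota> (emp_of M) = 0"
    and sing: "\<exists>p q. 0 \<le> p \<and> p \<le> 2 \<and> 0 \<le> q \<and> q \<le> 1 \<and> (\<forall>a. \<iota> (sing_of M a) = p * \<iota> a + q)"
    and uni: "(\<forall>a b. \<iota> (uni_of M a b) = \<iota> a + \<iota> b) \<or> (\<forall>a b. \<iota> (uni_of M a b) = max (\<iota> a) (\<iota> b))"
    and sub: "(\<iota> a \<le> \<iota> b \<longleftrightarrow> \<iota> a' \<le> \<iota> b') \<Longrightarrow> (1 \<le> \<iota> a \<longleftrightarrow> 1 \<le> \<iota> a') \<Longrightarrow>
      (1 \<le> \<iota> b \<longleftrightarrow> 1 \<le> \<iota> b') \<Longrightarrow> sub_of M a b \<longleftrightarrow> sub_of M a' b'"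
begin

text \<open>A single form works under both assignments although \<open>max\<close> depends on a
  comparison: similar assignments agree on which argument is larger. Codes grow fast enough that the
  size bound survives each constructor.\<close>

lemma val_lin:
  assumes "similar n L (\<iota> \<circ> e) (\<iota> \<circ> e')" "trm_code t < n" "2 * 2 ^ trm_code t \<le> L"
  shows "\<exists>f c. small (2 ^ trm_code t) f c \<and>
    \<iota> (val M e t) = lin n f c (\<iota> \<circ> e) \<and> \<iota> (val M e' t) = lin n f c (\<iota> \<circ> e')"
  using assms(2,3)
proof (induction t)
  case (Var x)
  have "x < n" using Var.prems(1) prod_encode_le(2)[of x 0] by simp
  then have "lin n (\<lambda>i. if i = x then 1 else 0) 0 u = u x" for u
    by (simp add: lin_def if_distrib[of "\<lambda>z. z * _"] cong: if_cong)
  then show ?case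
    by (intro exI[of _ "\<lambda>i. if i = x then 1 else 0"] exI[of _ 0]) (simp add: small_def)
next
  case Emp
  show ?case by (intro exI[of _ "\<lambda>i. 0"] exI[of _ 0]) (simp add: small_def lin_def emp)
next
  case (Sing t)
  \<comment> \<open>The tag 2 of \<open>Sing\<close> gains a factor 4 in the size bound, which pays
    for doubling and adding 1.\<close>
  have le: "2 + trm_code t \<le> trm_code \<langle>t\<rangle>" using add_le_prod_encode[of 2] by simp
  have "2 ^ (2 + trm_code t) \<le> (2::nat) ^ trm_code \<langle>t\<rangle>" using le by (intro power_increasing) auto
  then have pow: "4 * 2 ^ trm_code t \<le> (2::nat) ^ trm_code \<langle>t\<rangle>" by (simp add: power_add)
  have "trm_code t < n" using le Sing.prems(1) by simp
  moreover have "2 * 2 ^ trm_code t \<le> L" using pow Sing.prems(2) by linarith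
  ultimately obtain f c where f: "small (2 ^ trm_code t) f c"
    "\<iota> (val M e t) = lin n f c (\<iota> \<circ> e)" "\<iota> (val M e' t) = lin n f c (\<iota> \<circ> e')"
    using Sing.IH by blast
  obtain p q where pq: "0 \<le> p" "p \<le> 2" "0 \<le> q" "q \<le> 1" "\<And>a. \<iota> (sing_of M a) = p * \<iota> a + q"
    using sing by blast
  have "small (2 * 2 ^ trm_code t + 1) (\<lambda>i. p * f i) (p * c + q)"
    using pq by (intro small_add_const small_mult f(1)) auto
  moreover have "(2::int) * 2 ^ trm_code t + 1 \<le> 2 ^ trm_code \<langle>t\<rangle>"
  proof -
    have "1 \<le> (2::nat) ^ trm_code t" by simp
    then have "2 * 2 ^ trm_code t + 1 \<le> (2::nat) ^ trm_code \<langle>t\<rangle>" using pow by linarith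
    then have "int (2 * 2 ^ trm_code t + 1) \<le> int (2 ^ trm_code \<langle>t\<rangle>)" by (rule of_nat_mono)
    then show ?thesis by simp
  qed
  ultimately have "small (2 ^ trm_code \<langle>t\<rangle>) (\<lambda>i. p * f i) (p * c + q)" by (rule small_mono)
  then show ?case using f(2,3) pq(5) lin_mult lin_add_const by (metis val.simps(3))
next
  case (Uni s t)
  let ?a = "trm_code s" and ?b = "trm_code t" and ?c = "trm_code (s \<uplus> t)"
  have le: "3 + (?a + ?b) \<le> ?c"
    using add_le_prod_encode[of 3 "prod_encode (?a, ?b)"] add_le_prod_encode[of ?a ?b] by simp
  have pow: "(2::nat) ^ ?a + 2 ^ ?b \<le> 2 ^ ?c"
  proof -
    have "(2::nat) ^ ?a \<le> 2 ^ (?a + ?b)" "(2::nat) ^ ?b \<le> 2 ^ (?a + ?b)"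
      by (intro power_increasing; simp)+
    then have "(2::nat) ^ ?a + 2 ^ ?b \<le> 2 ^ (?a + ?b) + 2 ^ (?a + ?b)" by (rule add_mono)
    also have "\<dots> = 2 ^ Suc (?a + ?b)" by (simp add: mult_2)
    also have "\<dots> \<le> 2 ^ ?c" using le by (intro power_increasing) auto
    finally show ?thesis .
  qed
  have int_pow: "(2::int) ^ ?a + 2 ^ ?b \<le> 2 ^ ?c"
    using of_nat_mono[OF pow, where 'a = int] by simp
  have int_pow': "(2::int) ^ ?a \<le> 2 ^ ?c" "(2::int) ^ ?b \<le> 2 ^ ?c"
    using le by (intro power_increasing; simp)+
  have pow': "2 ^ ?a \<le> (2::nat) ^ ?c" "2 ^ ?b \<le> (2::nat) ^ ?c"
    using le by (intro power_increasing; simp)+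
  have "2 * 2 ^ ?a \<le> L" "2 * 2 ^ ?b \<le> L" "?a < n" "?b < n"
    using pow' le Uni.prems by linarith+
  then obtain f c g b where f: "small (2 ^ ?a) f c"
    "\<iota> (val M e s) = lin n f c (\<iota> \<circ> e)" "\<iota> (val M e' s) = lin n f c (\<iota> \<circ> e')"
    and g: "small (2 ^ ?b) g b"
    "\<iota> (val M e t) = lin n g b (\<iota> \<circ> e)" "\<iota> (val M e' t) = lin n g b (\<iota> \<circ> e')"
    using Uni.IH by metis
  from uni show ?case
  proof
    assume "\<forall>a b. \<iota> (uni_of M a b) = \<iota> a + \<iota> b"
    moreover have "small (2 ^ ?c) (\<lambda>i. f i + g i) (c + b)"
      using small_add[OF f(1) g(1)] int_pow by (rule small_mono)
    ultimately show ?thesis using f(2,3) g(2,3) lin_add by (metis val.simps(4))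
  next
    assume max: "\<forall>a b. \<iota> (uni_of M a b) = max (\<iota> a) (\<iota> b)"
    have "int (2 ^ ?a + 2 ^ ?b) \<le> int L" using pow Uni.prems(2) by (intro of_nat_mono) linarith
    then have "small (int L) (\<lambda>i. f i - g i) (c - b)"
      using small_diff[OF f(1) g(1)] small_mono by simp
    from similar_lin[OF assms(1) this]
    have "\<iota> (val M e t) \<le> \<iota> (val M e s) \<longleftrightarrow> \<iota> (val M e' t) \<le> \<iota> (val M e' s)"
      unfolding f(2,3) g(2,3) lin_diff[symmetric] by simp
    then consider "\<iota> (val M e t) \<le> \<iota> (val M e s)" "\<iota> (val M e' t) \<le> \<iota> (val M e' s)"
      | "\<iota> (val M e s) \<le> \<iota> (val M e t)" "\<iota> (val M e' s) \<le> \<iota> (val M e' t)" by linarith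
    then show ?thesis
    proof cases
      case 1
      then show ?thesis using f max small_mono[OF f(1) int_pow'(1)] by (metis max.absorb1 val.simps(4))
    next
      case 2
      then show ?thesis using g max small_mono[OF g(1) int_pow'(2)] by (metis max.absorb2 val.simps(4))
    qed
  qed
qed

text \<open>Equality of terms amounts to two such comparisons; the comparison with 1 is what the
  relation of \<open>M7\<close> tests.\<close>

lemma atom_similar:
  assumes sim: "similar n L (\<iota> \<circ> e) (\<iota> \<circ> e')" and code: "trm_code s + trm_code t < n"
    and L: "4 * 2 ^ (trm_code s + trm_code t) \<le> L"
  shows "\<iota> (val M e s) \<le> \<iota> (val M e t) \<longleftrightarrow> \<iota> (val M e' s) \<le> \<iota> (val M e' t)"
    and "1 \<le> \<iota> (val M e s) \<longleftrightarrow> 1 \<le> \<iota> (val M e' s)"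
proof -
  let ?a = "trm_code s" and ?b = "trm_code t"
  have pow: "2 ^ ?a \<le> (2::nat) ^ (?a + ?b)" "2 ^ ?b \<le> (2::nat) ^ (?a + ?b)" "1 \<le> (2::nat) ^ ?a"
    by (intro power_increasing; simp)+ simp
  then have "2 * 2 ^ ?a \<le> L" "2 * 2 ^ ?b \<le> L" "?a < n" "?b < n" using L code by linarith+
  then obtain f c g b where f: "small (2 ^ ?a) f c"
    "\<iota> (val M e s) = lin n f c (\<iota> \<circ> e)" "\<iota> (val M e' s) = lin n f c (\<iota> \<circ> e')"
    and g: "small (2 ^ ?b) g b"
    "\<iota> (val M e t) = lin n g b (\<iota> \<circ> e)" "\<iota> (val M e' t) = lin n g b (\<iota> \<circ> e')"
    using val_lin[OF sim] by metis
  have le: "int (2 ^ ?b + 2 ^ ?a) \<le> int L" "int (2 ^ ?a + 1) \<le> int L"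
    using pow L by (intro of_nat_mono; linarith)+
  have "small (int L) (\<lambda>i. g i - f i) (b - c)" using small_diff[OF g(1) f(1)] le(1) small_mono by simp
  from similar_lin[OF sim this]
  show "\<iota> (val M e s) \<le> \<iota> (val M e t) \<longleftrightarrow> \<iota> (val M e' s) \<le> \<iota> (val M e' t)"
    unfolding f(2,3) g(2,3) lin_diff[symmetric] by simp
  have "small (int L) f (c + - 1)" using small_add_const[OF f(1), of "- 1" 1] le(2) small_mono by simp
  from similar_lin[OF sim this]
  show "1 \<le> \<iota> (val M e s) \<longleftrightarrow> 1 \<le> \<iota> (val M e' s)"
    unfolding f(2,3) lin_add_const[symmetric] by (simp add: int_one_le_iff_zero_less)
qed

lemma extend:
  assumes sim: "similar n (4 * (fact L)\<^sup>2) (\<iota> \<circ> e) (\<iota> \<circ> e')" and L: "1 \<le> L" and x: "x < n"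
    and N: "\<And>i. i < n \<Longrightarrow> \<bar>\<iota> (e' i)\<bar> \<le> N"
  shows "\<exists>a'. similar n L (\<iota> \<circ> e(x := a)) (\<iota> \<circ> e'(x := a')) \<and>
    \<bar>\<iota> a'\<bar> \<le> 4 * (fact L)\<^sup>2 * (int n * N + 1)"
proof -
  obtain z where z: "similar n L ((\<iota> \<circ> e)(x := \<iota> a)) ((\<iota> \<circ> e')(x := z))"
    "\<bar>z\<bar> \<le> 4 * (fact L)\<^sup>2 * (int n * N + 1)"
    using similar_extend[OF sim x, of N] N by auto
  \<comment> \<open>The form consisting of the variable \<open>x\<close> alone transfers the sign of
    the new value, which is all that \<open>range\<close> asks for.\<close>
  have "small (int L) (\<lambda>i. if i = x then 1 else 0) 0" using L by (simp add: small_def)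
  from similar_lin[OF z(1) this] x have "0 \<le> \<iota> a \<longleftrightarrow> 0 \<le> z"
    by (simp add: lin_def if_distrib[of "\<lambda>z. z * _"] cong: if_cong)
  then obtain a' where "z = \<iota> a'" using range by blast
  with z show ?thesis by (auto simp: fun_upd_comp)
qed

text \<open>A quantifier is one move of the game in each direction, similarity being symmetric. The
  number \<open>n\<close> of variables stays fixed because the code bounds every variable index in
  the formula.\<close>

lemma sat_similar:
  "similar n L (\<iota> \<circ> e) (\<iota> \<circ> e') \<Longrightarrow> fm_code \<phi> < n \<Longrightarrow> prec (fm_code \<phi>) \<le> L \<Longrightarrow>
    sat M e \<phi> \<longleftrightarrow> sat M e' \<phi>"
proof (induction \<phi> arbitrary: L e e')
  case (Eq s t)
  let ?m = "trm_code s + trm_code t"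
  have "?m \<le> fm_code (s \<doteq> t)"
    using add_le_prod_encode[of "trm_code s" "trm_code t"] prod_encode_le(2)[of "prod_encode (trm_code s, trm_code t)" 0]
    by simp
  then have "4 * 2 ^ ?m \<le> L" "?m < n" using prec_ge[of ?m] prec_mono[of ?m] Eq.prems by (force, simp)
  then have "\<iota> (val M e s) = \<iota> (val M e t) \<longleftrightarrow> \<iota> (val M e' s) = \<iota> (val M e' t)"
    using atom_similar(1)[OF Eq.prems(1), of s t] atom_similar(1)[OF Eq.prems(1), of t s]
    by (simp add: add.commute order.eq_iff)
  then show ?case using inj by (metis sat.simps(1))
next
  case (Sub s t)
  let ?m = "trm_code s + trm_code t"
  have "?m \<le> fm_code (s \<sqsubseteq> t)"
    using add_le_prod_encode[of "trm_code s" "trm_code t"] prod_encode_le(2)[of "prod_encode (trm_code s, trm_code t)" 1]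
    by simp
  then have m: "4 * 2 ^ ?m \<le> L" "?m < n" using prec_ge[of ?m] prec_mono[of ?m] Sub.prems by (force, simp)
  have m': "4 * 2 ^ (trm_code t + trm_code s) \<le> L" "trm_code t + trm_code s < n"
    using m by (simp_all add: add.commute)
  show ?case unfolding sat.simps
    by (rule sub) (rule atom_similar[OF Sub.prems(1)], use m m' in simp_all)+
next
  case (Neg \<phi>)
  have "fm_code \<phi> \<le> fm_code (\<^bold>\<not> \<phi>)" by (simp add: prod_encode_le)
  then show ?case using Neg.IH[OF Neg.prems(1)] Neg.prems(2,3) prec_mono
    by (metis le_trans le_less_trans sat.simps(3))
next
  case (Imp \<phi> \<psi>)
  have "fm_code \<phi> \<le> fm_code (\<phi> \<^bold>\<longrightarrow> \<psi>)" "fm_code \<psi> \<le> fm_code (\<phi> \<^bold>\<longrightarrow> \<psi>)"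
    using add_le_prod_encode[of "fm_code \<phi>" "fm_code \<psi>"]
      add_le_prod_encode[of 3 "prod_encode (fm_code \<phi>, fm_code \<psi>)"] by simp_all
  then show ?case using Imp.IH[OF Imp.prems(1)] Imp.prems(2,3) prec_mono
    by (metis le_trans le_less_trans sat.simps(4))
next
  case (All x \<phi>)
  let ?c = "fm_code \<phi>"
  have le: "x + ?c + 4 \<le> fm_code (\<^bold>\<forall>x. \<phi>)"
    using add_le_prod_encode[of x ?c] add_le_prod_encode[of 4 "prod_encode (x, ?c)"] by simp
  then have "prec (Suc ?c) \<le> prec (fm_code (\<^bold>\<forall>x. \<phi>))" by (intro prec_mono) simp
  then have "prec (Suc ?c) \<le> L" using All.prems(3) by (rule le_trans)
  then have sim: "similar n (4 * (fact (prec ?c))\<^sup>2) (\<iota> \<circ> e) (\<iota> \<circ> e')"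
    using similar_mono[OF All.prems(1)] by (simp only: prec.simps)
  then have sim': "similar n (4 * (fact (prec ?c))\<^sup>2) (\<iota> \<circ> e') (\<iota> \<circ> e)"
    by (auto simp: similar_def dvd_diff_commute)
  have x: "x < n" "?c < n" and prec1: "1 \<le> prec ?c"
    using le All.prems(2) prec_pos[of ?c] by simp_all
  have forth: "\<exists>a'. sat M (e(x := a)) \<phi> \<longleftrightarrow> sat M (e'(x := a')) \<phi>"
    if "similar n (4 * (fact (prec ?c))\<^sup>2) (\<iota> \<circ> e) (\<iota> \<circ> e')" for e e' a
  proof -
    \<comment> \<open>Any bound on these finitely many values serves: only the existence of an
      answer matters here, not its size.\<close>
    have "\<bar>\<iota> (e' i)\<bar> \<le> (\<Sum>i<n. \<bar>\<iota> (e' i)\<bar>)" if "i < n" for i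
      using that by (intro member_le_sum) auto
    from extend[OF that prec1 x(1) this] obtain a' where
      "similar n (prec ?c) (\<iota> \<circ> e(x := a)) (\<iota> \<circ> e'(x := a'))" by blast
    from All.IH[OF this x(2) order_refl] show ?thesis by blast
  qed
  show ?case using forth[OF sim] forth[OF sim'] by (metis sat.simps(5))
qed

text \<open>The game is played from an assignment against itself: a move \<open>a\<close> is
  answered by an \<open>a'\<close> of bounded size that the formula cannot distinguish from
  \<open>a\<close>. \<open>H\<close> converts a bound on the size into a bound on the name.\<close>

lemma bounded_witness:
  fixes d :: "nat \<Rightarrow> 'a" and H :: "nat \<Rightarrow> nat"
  assumes d: "\<And>k. \<bar>\<iota> (d k)\<bar> \<le> int k" and H: "\<And>a B. \<bar>\<iota> a\<bar> \<le> int B \<Longrightarrow> \<exists>k\<le>H B. d k = a"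
    and c: "c = fm_code (\<^bold>\<forall>x. \<phi>)"
    and all: "\<And>k. k \<le> H (prec c * ((c + 1) * e + 1)) \<Longrightarrow> sat M ((env d e)(x := d k)) \<phi>"
  shows "sat M ((env d e)(x := a)) \<phi>"
proof -
  let ?c = "fm_code \<phi>"
  have le: "x + ?c + 4 \<le> c"
    using add_le_prod_encode[of x ?c] add_le_prod_encode[of 4 "prod_encode (x, ?c)"] by (simp add: c)
  have N: "\<bar>\<iota> (env d e i)\<bar> \<le> int e" if "i < c + 1" for i
    using d[of "lookup e i - 1"] lookup_le[of e i] by (simp add: env_def)
  have x: "x < c + 1" using le by simp
  obtain a' where a': "similar (c + 1) (prec ?c) (\<iota> \<circ> (env d e)(x := a)) (\<iota> \<circ> (env d e)(x := a'))"
    "\<bar>\<iota> a'\<bar> \<le> 4 * (fact (prec ?c))\<^sup>2 * (int (c + 1) * int e + 1)"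
    using extend[OF similar_refl prec_pos[of ?c] x, of "env d e" "int e" a] N by blast
  have "4 * (fact (prec ?c))\<^sup>2 = int (prec (Suc ?c))" by simp
  also have "\<dots> \<le> int (prec c)" using le by (intro of_nat_mono prec_mono) simp
  finally have "4 * (fact (prec ?c))\<^sup>2 * (int (c + 1) * int e + 1) \<le> int (prec c) * (int (c + 1) * int e + 1)"
    by (rule mult_right_mono) simp
  also have "\<dots> = int (prec c * ((c + 1) * e + 1))" by (simp add: algebra_simps)
  finally obtain k where k: "k \<le> H (prec c * ((c + 1) * e + 1))" "d k = a'"
    using a'(2) H by (meson order_trans)
  have "sat M ((env d e)(x := a)) \<phi> \<longleftrightarrow> sat M ((env d e)(x := a')) \<phi>"
    by (rule sat_similar[OF a'(1)]) (use le in simp_all)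
  then show ?thesis using all[OF k(1)] k(2) by simp
qed

end

section \<open>Soundness and theories of structures\<close>

lemma val_subst_trm: "val M e (subst_trm t x s) = val M (e(x := val M e s)) t"
  by (induction t) auto

lemma subst_trm_fresh: "x \<notin> fv_trm t \<Longrightarrow> subst_trm t x s = t"
  by (induction t) auto

lemma subst_fresh: "x \<notin> fv \<phi> \<Longrightarrow> subst \<phi> x s = \<phi>"
  by (induction \<phi>) (auto simp: subst_trm_fresh)

lemma sat_subst: "free_for s x \<phi> \<Longrightarrow> sat M e (subst \<phi> x s) \<longleftrightarrow> sat M (e(x := val M e s)) \<phi>"
proof (induction \<phi> arbitrary: e)
  case (All y \<phi>)
  show ?case
  proof (cases "x \<in> fv \<phi> - {y}")
    case True
    with All.prems have y: "y \<notin> fv_trm s" "free_for s x \<phi>" "y \<noteq> x" by auto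
    have "sat M (e(y := a)) (subst \<phi> x s) \<longleftrightarrow> sat M ((e(x := val M e s))(y := a)) \<phi>" for a
    proof -
      have "val M (e(y := a)) s = val M e s"
        by (rule val_cong) (use y(1) in auto)
      then show ?thesis
        unfolding All.IH[OF y(2)] fun_upd_twist[OF y(3)[symmetric], of e] by (simp only:)
    qed
    moreover have "subst (\<^bold>\<forall>y. \<phi>) x s = (\<^bold>\<forall>y. subst \<phi> x s)" using y(3) by simp
    ultimately show ?thesis by (simp only: sat.simps)
  next
    \<comment> \<open>Here \<open>free_for\<close> puts no restriction on \<open>s\<close>, but
      \<open>x\<close> is not free and the substitution changes nothing.\<close>
    case False
    then have "subst (\<^bold>\<forall>y. \<phi>) x s = (\<^bold>\<forall>y. \<phi>)" using subst_fresh[of x "\<^bold>\<forall>y. \<phi>" s] by simp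
    moreover have "sat M e (\<^bold>\<forall>y. \<phi>) \<longleftrightarrow> sat M (e(x := val M e s)) (\<^bold>\<forall>y. \<phi>)"
      by (rule sat_cong) (use False in auto)
    ultimately show ?thesis by (simp only:)
  qed
qed (simp_all add: val_subst_trm)

theorem soundness:
  assumes "T \<turnstile> \<phi>" "\<forall>\<psi>\<in>T. M \<Turnstile> \<psi>" shows "M \<Turnstile> \<phi>"
proof -
  have "sat M e \<phi>" for e
    using assms(1)
  proof (induction arbitrary: e rule: derives.induct)
    case (Ax \<phi>)
    then show ?case using assms(2) unfolding models_def by blast
  next
    case (Inst s x \<phi>)
    then show ?case by (simp add: sat_subst)
  next
    case (Distr x \<phi> \<psi>)
    have "sat M (e(x := a)) \<phi> \<longleftrightarrow> sat M e \<phi>" for a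
      by (rule sat_cong) (use Distr in auto)
    then show ?case by simp
  next
    case (Leibniz s x \<phi> t)
    then show ?case by (simp add: sat_subst)
  qed auto
  then show ?thesis unfolding models_def by blast
qed

lemma derives_mono: "T \<turnstile> \<phi> \<Longrightarrow> T \<subseteq> T' \<Longrightarrow> T' \<turnstile> \<phi>"
proof (induction rule: derives.induct)
  case (Ax \<phi>)
  then show ?case by (intro derives.Ax) blast
next
  case (MP \<phi> \<psi>)
  from MP.IH[OF MP.prems] show ?case by (rule derives.MP)
qed (rule derives.intros; assumption | (erule meta_mp, assumption))+

lemma consistent_model:
  assumes "\<forall>\<psi>\<in>T. M \<Turnstile> \<psi>" shows "consistent T"
  unfolding consistent_def
proof
  assume "\<exists>\<phi>. (T \<turnstile> \<phi>) \<and> (T \<turnstile> \<^bold>\<not> \<phi>)"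
  then obtain \<phi> where "T \<turnstile> \<phi>" "T \<turnstile> \<^bold>\<not> \<phi>" by blast
  from this[THEN soundness, OF assms] show False by (simp add: models_def)
qed

lemma Th_iff: "\<phi> \<in> Th M \<longleftrightarrow> sentence \<phi> \<and> (M \<Turnstile> \<phi>)"
  by (simp add: Th_def)

text \<open>A true sentence is itself an axiom of \<open>Th M\<close>; the converse is
  soundness.\<close>

lemma derives_Th:
  assumes "sentence \<phi>" shows "Th M \<turnstile> \<phi> \<longleftrightarrow> M \<Turnstile> \<phi>"
proof
  assume "Th M \<turnstile> \<phi>"
  then show "M \<Turnstile> \<phi>" by (rule soundness) (simp add: Th_iff)
next
  assume "M \<Turnstile> \<phi>"
  with assms show "Th M \<turnstile> \<phi>" by (intro Ax) (simp add: Th_iff)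
qed

lemma complete_Th: "complete_theory (Th M)"
  unfolding complete_theory_def
proof (intro allI impI)
  fix \<phi> assume \<phi>: "sentence \<phi>"
  then have n\<phi>: "sentence (\<^bold>\<not> \<phi>)" by (simp add: sentence_def)
 have "(M \<Turnstile> \<phi>) \<or> (M \<Turnstile> \<^bold>\<not> \<phi>)"
  proof (cases "M \<Turnstile> \<phi>")
    case False
    then have "\<not> sat M e \<phi>" for e using sentence_sat[OF \<phi>] by blast
    then show ?thesis by (simp add: models_def)
  qed simp
  then show "(Th M \<turnstile> \<phi>) \<or> (Th M \<turnstile> \<^bold>\<not> \<phi>)" unfolding derives_Th[OF \<phi>] derives_Th[OF n\<phi>]
    .
qed

lemma decidable_Th:
  assumes "recursive_set (fm_code ` Th M)" shows "decidable_theory (Th M)"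
proof -
  have "sentence \<phi> \<and> (Th M \<turnstile> \<phi>) \<longleftrightarrow> \<phi> \<in> Th M" for \<phi>
    using derives_Th[of \<phi> M] Th_iff[of \<phi> M] by blast
  then show ?thesis using assms by (simp only: decidable_theory_def Collect_mem_eq)
qed

lemma extends_Th:
  assumes "\<forall>\<psi>\<in>T. sentence \<psi> \<and> (M \<Turnstile> \<psi>)" shows "extends (Th M) T"
proof -
  have T: "T \<subseteq> Th M" using assms Th_iff by blast
  have "\<forall>\<phi>. (T \<turnstile> \<phi>) \<longrightarrow> (Th M \<turnstile> \<phi>)" using derives_mono[OF _ T] by blast
  then show ?thesis unfolding extends_def fo_theory_def using Th_iff by blast
qed

lemma sat_connectives [simp]:
  "sat M e (\<phi> \<^bold>\<and> \<psi>) \<longleftrightarrow> sat M e \<phi> \<and> sat M e \<psi>"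
  "sat M e (\<phi> \<^bold>\<or> \<psi>) \<longleftrightarrow> sat M e \<phi> \<or> sat M e \<psi>"
  "sat M e (\<phi> \<^bold>\<longleftrightarrow> \<psi>) \<longleftrightarrow> (sat M e \<phi> \<longleftrightarrow> sat M e \<psi>)"
  "sat M e (\<^bold>\<exists>x. \<phi>) \<longleftrightarrow> (\<exists>a. sat M (e(x := a)) \<phi>)"
  unfolding Con_def Dis_def Iff_def Exi_def by auto

section \<open>The five structures\<close>

lemma axiom_index: "j \<in> {1..9} \<longleftrightarrow> j \<in> {1, 2, 3, 4, 5, 6, 7, 8, 9 :: nat}"
  by auto

lemma F_simps:
  "F 1 = F1" "F 2 = F2" "F 3 = F3" "F 4 = F4" "F 5 = F5" "F 6 = F6" "F 7 = F7" "F 8 = F8" "F 9 = F9"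
  by (simp_all add: F_def numeral_eq_Suc)

lemmas F_defs = F1_def F2_def F3_def F4_def F5_def F6_def F7_def F8_def F9_def

lemma sentence_F: "j \<in> {1..9} \<Longrightarrow> sentence (F j)"
  unfolding axiom_index
  by (elim insertE emptyE; simp only: F_simps)
     (auto simp: F_defs sentence_def Con_def Dis_def Iff_def Exi_def)

lemma all_axioms_but:
  assumes "\<And>j. j \<in> {1, 2, 3, 4, 5, 6, 7, 8, 9} \<Longrightarrow> j \<noteq> i \<Longrightarrow> M \<Turnstile> F j"
  shows "\<forall>j\<in>{1..9} - {i}. M \<Turnstile> F j"
  using assms unfolding axiom_index[symmetric] by blast

lemma M4_axioms: "\<forall>j\<in>{1..9} - {4}. M4 \<Turnstile> F j" "M4 \<Turnstile> \<^bold>\<not> F 4"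
proof -
  have le: "x \<le> t \<longleftrightarrow> x = t \<or> (\<exists>w u. t = max w (Suc u) \<and> x \<le> u)" for x t :: nat
  proof
    assume "x \<le> t"
    then have "x = t \<or> t = max 0 (Suc (t - 1)) \<and> x \<le> t - 1" by auto
    then show "x = t \<or> (\<exists>w u. t = max w (Suc u) \<and> x \<le> u)" by blast
  qed auto
  have F8: "\<exists>w'. u = max (Suc x) w' \<or> v = max (Suc x) w'" if "max u v = max (Suc x) w" for u v x w :: nat
  proof -
    \<comment> \<open>The larger of \<open>u\<close> and \<open>v\<close> is at least
      \<open>Suc x\<close> and absorbs it, so it is its own witness.\<close>
    have "u = max (Suc x) u \<or> v = max (Suc x) v" using that by linarith
    then show ?thesis by blast
  qed
  show "\<forall>j\<in>{1..9} - {4}. M4 \<Turnstile> F j"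
  proof (rule all_axioms_but, elim insertE emptyE; simp only: F_simps)
    show "M4 \<Turnstile> F9" by (simp add: F9_def models_def M4_def) (intro allI le)
    show "M4 \<Turnstile> F8" by (simp add: F8_def models_def M4_def) (intro allI impI, elim exE, erule F8)
    show "M4 \<Turnstile> F2" by (simp add: F2_def models_def M4_def max.commute)
    show "M4 \<Turnstile> F6" by (simp add: F6_def models_def M4_def)
    show "M4 \<Turnstile> F1" unfolding models_def F1_def by (simp add: M4_def max.assoc)
    show "M4 \<Turnstile> F3" unfolding models_def F3_def by (simp add: M4_def)
    show "M4 \<Turnstile> F5" unfolding models_def F5_def by (simp add: M4_def)
    show "M4 \<Turnstile> F7" unfolding models_def F7_def by (simp add: M4_def)
  qed
  have "\<not> sat M4 e F4" for e
  proof
    assume "sat M4 e F4"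
    \<comment> \<open>Cancellation fails for \<open>max\<close> at 0, 1, 1: the common summand 1
      absorbs both.\<close>
    then have "sat M4 (e(0 := 0, 1 := 1, 2 := 1)) (Var 0 \<uplus> Var 2 \<doteq> Var 1 \<uplus> Var 2 \<^bold>\<longrightarrow> Var 0 \<doteq> Var 1)"
      unfolding F4_def sat.simps(5) by blast
    then show False by (simp add: M4_def)
  qed
  then show "M4 \<Turnstile> \<^bold>\<not> F 4" unfolding F_simps models_def by simp
qed

lemma M5_axioms: "\<forall>j\<in>{1..9} - {5}. M5 \<Turnstile> F j" "M5 \<Turnstile> \<^bold>\<not> F 5"
proof -
  have all: "x = y" for x y :: num1 by (simp only: num1_eq_iff)
  show "\<forall>j\<in>{1..9} - {5}. M5 \<Turnstile> F j"
    by (rule all_axioms_but, elim insertE emptyE; simp only: F_simps)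
       (auto simp: F_defs models_def M5_def all)
  show "M5 \<Turnstile> \<^bold>\<not> F 5" unfolding F_simps F5_def models_def M5_def by auto
qed

lemma M6_axioms: "\<forall>j\<in>{1..9} - {6}. M6 \<Turnstile> F j" "M6 \<Turnstile> \<^bold>\<not> F 6"
proof -
  \<comment> \<open>Subtraction supplies every existential in F8 and F9; F5 holds because odd
    numbers are nonzero.\<close>
  have minus: "\<exists>w'. u = y + w'" "\<exists>w. u = w + y" for u y :: int
    by (rule exI[of _ "u - y"], simp)+
  show "\<forall>j\<in>{1..9} - {6}. M6 \<Turnstile> F j"
  proof (rule all_axioms_but, elim insertE emptyE; simp only: F_simps)
    show "M6 \<Turnstile> F9" using minus(2) by (simp add: F9_def models_def M6_def) blast
    show "M6 \<Turnstile> F8" using minus(1) by (simp add: F8_def models_def M6_def) blast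
    show "M6 \<Turnstile> F5" by (simp add: F5_def models_def M6_def) presburger
  qed (auto simp: F_defs models_def M6_def)
  have "\<not> sat M6 e F6" for e
  proof
    assume "sat M6 e F6"
    then have "sat M6 (e(0 := 1, 1 := - 1)) (Var 0 \<uplus> Var 1 \<doteq> \<^bold>\<emptyset> \<^bold>\<longrightarrow> Var 0 \<doteq> \<^bold>\<emptyset>)"
      unfolding F6_def sat.simps(5) by blast
    then show False by (simp add: M6_def)
  qed
  then show "M6 \<Turnstile> \<^bold>\<not> F 6" unfolding F_simps models_def by simp
qed

lemma M7_axioms: "\<forall>j\<in>{1..9} - {7}. M7 \<Turnstile> F j" "M7 \<Turnstile> \<^bold>\<not> F 7"
proof -
  \<comment> \<open>In \<open>M7\<close> every element stands in the relation to 1, so for positive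
    \<open>t\<close> the witness \<open>u = 1\<close> always works.\<close>
  have "\<exists>u. Suc 0 \<le> u \<or> x = 0 \<and> u = 0" for x :: nat by (rule exI[of _ 1]) simp
  then have F9: "(Suc 0 \<le> t \<or> x = 0 \<and> t = 0) \<longleftrightarrow>
      x = t \<or> (\<exists>w. t = Suc w) \<and> (\<exists>u. Suc 0 \<le> u \<or> x = 0 \<and> u = 0)" for x t :: nat
    by (cases t) simp_all
  have F8: "\<exists>w'. u = Suc w' \<or> v = Suc w'" if "u + v = Suc w" for u v w :: nat
    using that by (cases u) auto
  show "\<forall>j\<in>{1..9} - {7}. M7 \<Turnstile> F j"
  proof (rule all_axioms_but, elim insertE emptyE; simp only: F_simps)
    show "M7 \<Turnstile> F9" by (simp add: F9_def models_def M7_def) (intro allI F9)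
    show "M7 \<Turnstile> F8" by (simp add: F8_def models_def M7_def) (intro allI impI, elim exE, erule F8)
  qed (auto simp: F_defs models_def M7_def)
  have "\<not> sat M7 e F7" for e
  proof
    assume "sat M7 e F7"
    then have "sat M7 (e(0 := 0, 1 := 1)) (\<langle>Var 0\<rangle> \<doteq> \<langle>Var 1\<rangle> \<^bold>\<longrightarrow> Var 0 \<doteq> Var 1)"
      unfolding F7_def sat.simps(5) by blast
    then show False by (simp add: M7_def)
  qed
  then show "M7 \<Turnstile> \<^bold>\<not> F 7" unfolding F_simps models_def by simp
qed

lemma M8_axioms: "\<forall>j\<in>{1..9} - {8}. M8 \<Turnstile> F j" "M8 \<Turnstile> \<^bold>\<not> F 8"
proof -
  have le: "x \<le> t \<longleftrightarrow> x = t \<or> (\<exists>w u. t = Suc (w + u) \<and> x \<le> u)" for x t :: nat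
  proof
    assume "x \<le> t"
    then have "x = t \<or> t = Suc (0 + (t - 1)) \<and> x \<le> t - 1" by auto
    then show "x = t \<or> (\<exists>w u. t = Suc (w + u) \<and> x \<le> u)" by blast
  qed auto
  show "\<forall>j\<in>{1..9} - {8}. M8 \<Turnstile> F j"
  proof (rule all_axioms_but, elim insertE emptyE; simp only: F_simps)
    show "M8 \<Turnstile> F9" by (simp add: F9_def models_def M8_def) (intro allI le)
  qed (auto simp: F_defs models_def M8_def)
  have "\<not> sat M8 e F8" for e
  proof
    assume "sat M8 e F8"
    \<comment> \<open>The sum 1+1 equals 2+0, yet neither summand 1 is of the form 2+w'.\<close>
    then have "sat M8 (e(0 := 1, 1 := 1, 2 := 1, 3 := 0)) (Var 1 \<uplus> Var 2 \<doteq> \<langle>Var 0\<rangle> \<uplus> Var 3 \<^bold>\<longrightarrow>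
     (\<^bold>\<exists>4. (Var 1 \<doteq> \<langle>Var 0\<rangle> \<uplus> Var 4) \<^bold>\<or> (Var 2 \<doteq> \<langle>Var 0\<rangle> \<uplus> Var 4)))"
      unfolding F8_def sat.simps(5) by blast
    then show False by (simp add: M8_def)
  qed
  then show "M8 \<Turnstile> \<^bold>\<not> F 8" unfolding F_simps models_def by simp
qed

section \<open>Decidability of the five theories\<close>

lemma recursive_set_Th_nat:
  fixes M :: "nat lstruct"
  assumes lin: "lin_struct M int"
    and sing: "computable (\<lambda>\<rho>. sing_of M (\<rho> 0))" and uni: "computable (\<lambda>\<rho>. uni_of M (\<rho> 0) (\<rho> 1))"
    and sub: "decidable (\<lambda>\<rho>. sub_of M (\<rho> 0) (\<rho> 1))"
  shows "recursive_set (fm_code ` Th M)"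
proof -
  have "coded_struct M id (emp_of M) (sing_of M) (uni_of M) (=) (sub_of M)
      (\<lambda>c e. prec c * ((c + 1) * e + 1))"
  proof
    fix x \<phi> e a
    assume "\<And>k. k \<le> prec (fm_code (\<^bold>\<forall>x. \<phi>)) * ((fm_code (\<^bold>\<forall>x. \<phi>) + 1) * e + 1) \<Longrightarrow>
      sat M ((env id e)(x := id k)) \<phi>"
    then show "sat M ((env id e)(x := a)) \<phi>"
      by (rule lin_struct.bounded_witness[OF lin, of id "\<lambda>B. B", OF _ _ refl, rotated 2]) simp_all
  next
    show "computable (\<lambda>\<rho>. prec (\<rho> 0) * ((\<rho> 0 + 1) * \<rho> 1 + 1))" by (intro computable_intros)
    show "decidable (\<lambda>\<rho>. \<rho> 0 = \<rho> 1)" by (intro computable_intros)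
  qed (simp_all add: sing uni sub del: One_nat_def)
  then show ?thesis by (rule coded_struct.recursive_set_Th)
qed

lemma recursive_set_Th_M4: "recursive_set (fm_code ` Th M4)"
proof (rule recursive_set_Th_nat)
  show "lin_struct M4 int"
    by unfold_locales (auto simp: M4_def intro: range_eqI[of _ int "nat _"] exI[of _ 1])
  have "max x y = (if x \<le> y then y else x)" for x y :: nat by simp
  then show "computable (\<lambda>\<rho>. uni_of M4 (\<rho> 0) (\<rho> 1))"
    by (simp add: M4_def) (intro computable_intros)
qed (simp_all add: M4_def, (intro computable_intros)+)

lemma recursive_set_Th_M7: "recursive_set (fm_code ` Th M7)"
proof (rule recursive_set_Th_nat)
  show "lin_struct M7 int"
    by unfold_locales (auto simp: M7_def intro: range_eqI[of _ int "nat _"] exI[of _ 0] exI[of _ 1])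
qed (simp_all add: M7_def, (intro computable_intros)+)

lemma recursive_set_Th_M8: "recursive_set (fm_code ` Th M8)"
proof (rule recursive_set_Th_nat)
  show "lin_struct M8 int"
    by unfold_locales (auto simp: M8_def intro: range_eqI[of _ int "nat _"] exI[of _ 1])
qed (simp_all add: M8_def, (intro computable_intros)+)

lemma recursive_set_Th_M5: "recursive_set (fm_code ` Th M5)"
proof -
  have all: "x = y" for x y :: num1 by (simp only: num1_eq_iff)
  \<comment> \<open>Every number names the only element, so the quantifier bound 0 suffices.\<close>
  have "coded_struct M5 (\<lambda>k. 0) 0 (\<lambda>k. 0) (\<lambda>k l. 0) (\<lambda>k l. True) (\<lambda>k l. True) (\<lambda>c e. 0)"
  proof
    show "sat M5 ((env (\<lambda>k. 0) e)(x := a)) \<phi>"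
      if "\<And>k::nat. k \<le> 0 \<Longrightarrow> sat M5 ((env (\<lambda>k. 0) e)(x := 0)) \<phi>" for x \<phi> e a
      using that[of 0] all[of a 0] by simp
  qed (simp_all add: M5_def, (intro computable_intros)+)
  then show ?thesis by (rule coded_struct.recursive_set_Th)
qed

text \<open>An integer is coded by any pair of naturals of which it is the difference.\<close>

lemma recursive_set_Th_M6: "recursive_set (fm_code ` Th M6)"
proof -
  define d where "d k = int (pfst k) - int (psnd k)" for k
  \<comment> \<open>Among the pairs \<open>(i, j)\<close> with \<open>i + j \<le> B\<close>, the
    pair \<open>(B, 0)\<close> has the largest code, so names of all integers of size at most
    \<open>B\<close> occur below it.\<close>
  let ?H = "\<lambda>B. prod_encode (B, 0)"
  have lin: "lin_struct M6 id"
    by unfold_locales (auto simp: M6_def intro: exI[of _ 2] exI[of _ 1])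
  have d: "\<bar>id (d k)\<bar> \<le> int k" for k
    using pfst_le[of k] psnd_le[of k] by (simp add: d_def)
  have H: "\<exists>k\<le>?H B. d k = a" if "\<bar>id a\<bar> \<le> int B" for a B
  proof -
    let ?k = "if 0 \<le> a then prod_encode (nat a, 0) else prod_encode (0, nat (- a))"
    have "triangle m \<le> triangle n" if "m \<le> n" for m n
      using that by (rule lift_Suc_mono_le[rotated]) simp
    then have "?k \<le> ?H B" using that by (auto simp: prod_encode_def intro: add_mono trans_le_add1)
    moreover have "d ?k = a" by (simp add: d_def)
    ultimately show ?thesis by blast
  qed
  have "coded_struct M6 d 0 (\<lambda>k. prod_encode (2 * pfst k + 1, 2 * psnd k))
      (\<lambda>k l. prod_encode (pfst k + pfst l, psnd k + psnd l)) (\<lambda>k l. pfst k + psnd l = pfst l + psnd k)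
      (\<lambda>k l. True) (\<lambda>c e. ?H (prec c * ((c + 1) * e + 1)))"
  proof
    fix x \<phi> e a
    assume *: "\<And>k. k \<le> ?H (prec (fm_code (\<^bold>\<forall>x. \<phi>)) * ((fm_code (\<^bold>\<forall>x. \<phi>) + 1) * e + 1)) \<Longrightarrow>
      sat M6 ((env d e)(x := d k)) \<phi>"
    show "sat M6 ((env d e)(x := a)) \<phi>"
      by (rule lin_struct.bounded_witness[OF lin d _ refl, where H = ?H]) (erule H, erule *)
  next
    show "d 0 = emp_of M6" using pfst_le[of 0] psnd_le[of 0] by (simp add: d_def M6_def)
  qed (simp_all add: M6_def d_def, (auto; fail)?, (intro computable_intros)+)
  then show ?thesis by (rule coded_struct.recursive_set_Th)
qed

text \<open>\<open>Th M\<close> is the decidable consistent extension that defeats essential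
  undecidability. Consistency of \<open>Fminus_without i\<close> is stated alongside, since an
  inconsistent theory would fail to be essentially undecidable for a trivial reason.\<close>

lemma independent_axiom:
  assumes i: "i \<in> {4..8}" and ax: "\<forall>j\<in>{1..9} - {i}. M \<Turnstile> F j" "M \<Turnstile> \<^bold>\<not> F i"
    and rec: "recursive_set (fm_code ` Th M)"
  shows "(\<forall>j\<in>{1..9} - {i}. M \<Turnstile> F j) \<and> (M \<Turnstile> \<^bold>\<not> F i) \<and>
      extends (Th M) (Fminus_without i) \<and> consistent (Th M) \<and>
      complete_theory (Th M) \<and> decidable_theory (Th M)"
    and "\<not> (Fminus_without i \<turnstile> F i) \<and> consistent (Fminus_without i) \<and>
      \<not> essentially_undecidable (Fminus_without i)"
proof -
  have T: "\<forall>\<psi>\<in>Fminus_without i. sentence \<psi> \<and> (M \<Turnstile> \<psi>)"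
    using ax(1) sentence_F by (auto simp: Fminus_without_def)
  have ext: "extends (Th M) (Fminus_without i)" using T by (rule extends_Th)
  have con: "consistent (Th M)" by (rule consistent_model[of _ M]) (simp add: Th_def)
  have dec: "decidable_theory (Th M)" using rec by (rule decidable_Th)
  show "(\<forall>j\<in>{1..9} - {i}. M \<Turnstile> F j) \<and> (M \<Turnstile> \<^bold>\<not> F i) \<and>
      extends (Th M) (Fminus_without i) \<and> consistent (Th M) \<and>
      complete_theory (Th M) \<and> decidable_theory (Th M)"
    using ax ext con complete_Th dec by blast
  have "\<not> (M \<Turnstile> F i)" using ax(2) unfolding models_def by simp
  then have "\<not> (Fminus_without i \<turnstile> F i)" using soundness T by blast
  moreover have "consistent (Fminus_without i)" using T consistent_model by blast
  ultimately show "\<not> (Fminus_without i \<turnstile> F i) \<and> consistent (Fminus_without i) \<and>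
      \<not> essentially_undecidable (Fminus_without i)"
    using ext con dec unfolding essentially_undecidable_def by blast
qed

theorem theorem7p2:
  shows "((\<forall>j\<in>{1..9} - {4}. M4 \<Turnstile> F j) \<and> (M4 \<Turnstile> \<^bold>\<not> F 4) \<and>
      extends (Th M4) (Fminus_without 4) \<and> consistent (Th M4) \<and>
      complete_theory (Th M4) \<and> decidable_theory (Th M4)) \<and>
     ((\<forall>j\<in>{1..9} - {5}. M5 \<Turnstile> F j) \<and> (M5 \<Turnstile> \<^bold>\<not> F 5) \<and>
      extends (Th M5) (Fminus_without 5) \<and> consistent (Th M5) \<and>
      complete_theory (Th M5) \<and> decidable_theory (Th M5)) \<and>
     ((\<forall>j\<in>{1..9} - {6}. M6 \<Turnstile> F j) \<and> (M6 \<Turnstile> \<^bold>\<not> F 6) \<and>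
      extends (Th M6) (Fminus_without 6) \<and> consistent (Th M6) \<and>
      complete_theory (Th M6) \<and> decidable_theory (Th M6)) \<and>
     ((\<forall>j\<in>{1..9} - {7}. M7 \<Turnstile> F j) \<and> (M7 \<Turnstile> \<^bold>\<not> F 7) \<and>
      extends (Th M7) (Fminus_without 7) \<and> consistent (Th M7) \<and>
      complete_theory (Th M7) \<and> decidable_theory (Th M7)) \<and>
     ((\<forall>j\<in>{1..9} - {8}. M8 \<Turnstile> F j) \<and> (M8 \<Turnstile> \<^bold>\<not> F 8) \<and>
      extends (Th M8) (Fminus_without 8) \<and> consistent (Th M8) \<and>
      complete_theory (Th M8) \<and> decidable_theory (Th M8)) \<and>
     (\<forall>i\<in>{4..8}. \<not> (Fminus_without i \<turnstile> F i) \<and> consistent (Fminus_without i) \<and>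
        \<not> essentially_undecidable (Fminus_without i))"
proof -
  have i: "4 \<in> {4..8::nat}" "5 \<in> {4..8::nat}" "6 \<in> {4..8::nat}" "7 \<in> {4..8::nat}" "8 \<in> {4..8::nat}"
    by simp_all
  have range: "{4..8} = {4, 5, 6, 7, 8 :: nat}" by auto
  note ind4 = independent_axiom[OF i(1) M4_axioms recursive_set_Th_M4]
  note ind5 = independent_axiom[OF i(2) M5_axioms recursive_set_Th_M5]
  note ind6 = independent_axiom[OF i(3) M6_axioms recursive_set_Th_M6]
  note ind7 = independent_axiom[OF i(4) M7_axioms recursive_set_Th_M7]
  note ind8 = independent_axiom[OF i(5) M8_axioms recursive_set_Th_M8]
  have "\<forall>i\<in>{4..8}. \<not> (Fminus_without i \<turnstile> F i) \<and> consistent (Fminus_without i) \<and>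
        \<not> essentially_undecidable (Fminus_without i)"
    unfolding range using ind4(2) ind5(2) ind6(2) ind7(2) ind8(2) by blast
  then show ?thesis using ind4(1) ind5(1) ind6(1) ind7(1) ind8(1) by (intro conjI) blast+
qed

end
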